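(* Let $A$ be an $(o,p,h)$-array whose elements all have length at most $|o|+d$. Then $|A|\le h\,\frac{(|o|+d)!}{|o|!}$.
   Context: $\mathbb M$ is a countable nonstandard model of true arithmetic; $n\in\mathbb M$ nonstandard; $[0,\dots,n)=\{0,\dots,n-1\}$; $|o|$ denotes the length of a sequence $o$. $\mathbb O$ is the set of sequences (in $\mathbb M$) of distinct numbers from $[0,\dots,n)$ of length at most $|n|^c$ for some standard $c$ ($|n|$ the bit length of $n$); $o$ induces the strict order $\triangleleft_o$ on its entries by listing order; $o'\preceq o$ if $\triangleleft_{o'}\supseteq\triangleleft_o$; $o\parallel o'$ if some element of $\mathbb O$ extends both, otherwise incompatible. $(o,p,h)$-array (for $o\in\mathbb O$, $p,h\in\mathbb M$): an indexed family $\{A_{a,b}\}_{a<p,b<h}$ definable in $\mathbb M$ with $A_{a,b}\subseteq\mathbb O$ such that: every element of every $A_{a,b}$ extends $o$; distinct elements of the same cell are incompatible; elements of $A_{a,b}$ and $A_{a',b}$ ($a\ne a'$) are incompatible; elements of $A_{a,b}$ and $A_{a,b'}$ ($b\ne b'$) are incompatible; for every $q\preceq o$ in $\mathbb O$ and every $a<p$ there are $b<h$ and $r\in A_{a,b}$ compatible with $q$. Its size is $|A|=\sum_{a<p,b<h}|A_{a,b}|$ (cardinalities in $\mathbb M$). *)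

theory Defs
  imports Main "HOL-Library.Countable_Set"
begin

text \<open>First-order arithmetic in the language with symbols 0, 1, +, *, <, with de Bruijn variables.\<close>

datatype tm = Var nat | Zero | One | Add tm tm | Mul tm tm

datatype fm = Eq tm tm | Less tm tm | Neg fm | Conj fm fm | Exi fm

record 'm arith =
  zero :: 'm  ("\<zero>\<index>")
  one :: 'm  ("\<one>\<index>")
  add :: "'m \<Rightarrow> 'm \<Rightarrow> 'm"  (infixl "\<oplus>\<index>" 65)
  mul :: "'m \<Rightarrow> 'm \<Rightarrow> 'm"  (infixl "\<otimes>\<index>" 70)
  less :: "'m \<Rightarrow> 'm \<Rightarrow> bool"  (infix "\<prec>\<index>" 50)

definition le :: "'m arith \<Rightarrow> 'm \<Rightarrow> 'm \<Rightarrow> bool"  ("(_/ \<preceq>\<index> _)" [51, 51] 50)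
  where "le M x y \<longleftrightarrow> x \<prec>\<^bsub>M\<^esub> y \<or> x = y"

fun tval :: "'m arith \<Rightarrow> (nat \<Rightarrow> 'm) \<Rightarrow> tm \<Rightarrow> 'm" where
  "tval M e (Var i) = e i"
| "tval M e Zero = \<zero>\<^bsub>M\<^esub>"
| "tval M e One = \<one>\<^bsub>M\<^esub>"
| "tval M e (Add s t) = tval M e s \<oplus>\<^bsub>M\<^esub> tval M e t"
| "tval M e (Mul s t) = tval M e s \<otimes>\<^bsub>M\<^esub> tval M e t"

fun sat :: "'m arith \<Rightarrow> (nat \<Rightarrow> 'm) \<Rightarrow> fm \<Rightarrow> bool" where
  "sat M e (Eq s t) \<longleftrightarrow> tval M e s = tval M e t"
| "sat M e (Less s t) \<longleftrightarrow> tval M e s \<prec>\<^bsub>M\<^esub> tval M e t"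
| "sat M e (Neg \<phi>) \<longleftrightarrow> \<not> sat M e \<phi>"
| "sat M e (Conj \<phi> \<psi>) \<longleftrightarrow> sat M e \<phi> \<and> sat M e \<psi>"
| "sat M e (Exi \<phi>) \<longleftrightarrow> (\<exists>v. sat M (case_nat v e) \<phi>)"

fun tm_below :: "nat \<Rightarrow> tm \<Rightarrow> bool" where
  "tm_below k (Var i) \<longleftrightarrow> i < k"
| "tm_below k Zero \<longleftrightarrow> True"
| "tm_below k One \<longleftrightarrow> True"
| "tm_below k (Add s t) \<longleftrightarrow> tm_below k s \<and> tm_below k t"
| "tm_below k (Mul s t) \<longleftrightarrow> tm_below k s \<and> tm_below k t"

fun fm_below :: "nat \<Rightarrow> fm \<Rightarrow> bool" where
  "fm_below k (Eq s t) \<longleftrightarrow> tm_below k s \<and> tm_below k t"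
| "fm_below k (Less s t) \<longleftrightarrow> tm_below k s \<and> tm_below k t"
| "fm_below k (Neg \<phi>) \<longleftrightarrow> fm_below k \<phi>"
| "fm_below k (Conj \<phi> \<psi>) \<longleftrightarrow> fm_below k \<phi> \<and> fm_below k \<psi>"
| "fm_below k (Exi \<phi>) \<longleftrightarrow> fm_below (Suc k) \<phi>"

definition sentence :: "fm \<Rightarrow> bool"
  where "sentence \<phi> \<longleftrightarrow> fm_below 0 \<phi>"

definition models :: "'m arith \<Rightarrow> fm \<Rightarrow> bool"
  where "models M \<phi> \<longleftrightarrow> (\<forall>e. sat M e \<phi>)"

definition nat_arith :: "nat arith"
  where "nat_arith = \<lparr>zero = 0, one = 1, add = (+), mul = (*), less = (<)\<rparr>"

definition true_arithmetic :: "'m arith \<Rightarrow> bool"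
  where "true_arithmetic M \<longleftrightarrow> (\<forall>\<phi>. sentence \<phi> \<and> models nat_arith \<phi> \<longrightarrow> models M \<phi>)"

definition standard :: "'m arith \<Rightarrow> 'm set"
  where "standard M = range (\<lambda>k::nat. ((\<lambda>x. x \<oplus>\<^bsub>M\<^esub> \<one>\<^bsub>M\<^esub>) ^^ k) \<zero>\<^bsub>M\<^esub>)"

definition nonstandard_model :: "'m arith \<Rightarrow> bool"
  where "nonstandard_model M \<longleftrightarrow> standard M \<noteq> UNIV"

text \<open>
  Definability of a \<open>k\<close>-ary relation, with parameters. The tuple is assigned to the variables
  \<open>0, \<dots>, k-1\<close> and the parameters \<open>e\<close> to the remaining ones; a formula mentions only finitely
  many of them.
\<close>

definition definable :: "'m arith \<Rightarrow> nat \<Rightarrow> ('m list \<Rightarrow> bool) \<Rightarrow> bool"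
  where "definable M k R \<longleftrightarrow> (\<exists>\<phi> e. \<forall>xs. length xs = k \<longrightarrow>
    (R xs \<longleftrightarrow> sat M (\<lambda>i. if i < k then xs ! i else e (i - k)) \<phi>))"

definition below :: "'m arith \<Rightarrow> 'm \<Rightarrow> 'm set"
  where "below M x = {i. i \<prec>\<^bsub>M\<^esub> x}"

text \<open>
  Functions given by recursion inside \<open>M\<close>: the value at \<open>k\<close> is read off a definable function
  satisfying the recursion equations below \<open>k\<close>. Definability is what makes this value unique, by
  induction in \<open>M\<close>; on the nonstandard part the equations alone do not determine it.
\<close>

definition mrec :: "'m arith \<Rightarrow> 'm \<Rightarrow> ('m \<Rightarrow> 'm \<Rightarrow> 'm) \<Rightarrow> 'm \<Rightarrow> 'm"
  where "mrec M z g k = (THE v. \<exists>S. definable M 2 (\<lambda>xs. xs ! 1 = S (xs ! 0)) \<and>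
    S \<zero>\<^bsub>M\<^esub> = z \<and> (\<forall>i \<in> below M k. S (i \<oplus>\<^bsub>M\<^esub> \<one>\<^bsub>M\<^esub>) = g i (S i)) \<and> S k = v)"

definition mfact :: "'m arith \<Rightarrow> 'm \<Rightarrow> 'm"
  where "mfact M = mrec M \<one>\<^bsub>M\<^esub> (\<lambda>i v. (i \<oplus>\<^bsub>M\<^esub> \<one>\<^bsub>M\<^esub>) \<otimes>\<^bsub>M\<^esub> v)"

definition mexp2 :: "'m arith \<Rightarrow> 'm \<Rightarrow> 'm"
  where "mexp2 M = mrec M \<one>\<^bsub>M\<^esub> (\<lambda>i v. (\<one>\<^bsub>M\<^esub> \<oplus>\<^bsub>M\<^esub> \<one>\<^bsub>M\<^esub>) \<otimes>\<^bsub>M\<^esub> v)"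

text \<open>The sum of \<open>f i\<close> over \<open>i \<prec> k\<close>.\<close>

definition msum :: "'m arith \<Rightarrow> ('m \<Rightarrow> 'm) \<Rightarrow> 'm \<Rightarrow> 'm"
  where "msum M f = mrec M \<zero>\<^bsub>M\<^esub> (\<lambda>i v. v \<oplus>\<^bsub>M\<^esub> f i)"

definition mdiv :: "'m arith \<Rightarrow> 'm \<Rightarrow> 'm \<Rightarrow> 'm"
  where "mdiv M x y = (THE q. \<exists>r. r \<prec>\<^bsub>M\<^esub> y \<and> x = q \<otimes>\<^bsub>M\<^esub> y \<oplus>\<^bsub>M\<^esub> r)"

definition mmod :: "'m arith \<Rightarrow> 'm \<Rightarrow> 'm \<Rightarrow> 'm"
  where "mmod M x y = (THE r. r \<prec>\<^bsub>M\<^esub> y \<and> (\<exists>q. x = q \<otimes>\<^bsub>M\<^esub> y \<oplus>\<^bsub>M\<^esub> r))"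

text \<open>Bit length: the least \<open>k\<close> with \<open>x < 2\<^sup>k\<close>.\<close>

definition bitlen :: "'m arith \<Rightarrow> 'm \<Rightarrow> 'm"
  where "bitlen M x = (THE k. x \<prec>\<^bsub>M\<^esub> mexp2 M k \<and> (\<forall>j \<in> below M k. mexp2 M j \<preceq>\<^bsub>M\<^esub> x))"

text \<open>Powers with a standard exponent.\<close>

definition spow :: "'m arith \<Rightarrow> 'm \<Rightarrow> nat \<Rightarrow> 'm"
  where "spow M x c = ((\<lambda>v. x \<otimes>\<^bsub>M\<^esub> v) ^^ c) \<one>\<^bsub>M\<^esub>"

text \<open>
  Sequences in \<open>M\<close> are the partial functions on a proper initial segment \<open>{i. i \<prec> l}\<close> of \<open>M\<close>
  that are coded in \<open>M\<close> by Goedel's beta function. A sequence has many codes \<open>(l, x, y)\<close>; working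
  with the partial function rather than its codes makes equality and cardinality extensional.
\<close>

type_synonym 'm mseq = "'m \<Rightarrow> 'm option"

definition beta :: "'m arith \<Rightarrow> 'm \<Rightarrow> 'm \<Rightarrow> 'm \<Rightarrow> 'm"
  where "beta M x y i = mmod M x (\<one>\<^bsub>M\<^esub> \<oplus>\<^bsub>M\<^esub> (i \<oplus>\<^bsub>M\<^esub> \<one>\<^bsub>M\<^esub>) \<otimes>\<^bsub>M\<^esub> y)"

definition decode :: "'m arith \<Rightarrow> 'm \<Rightarrow> 'm \<Rightarrow> 'm \<Rightarrow> 'm mseq"
  where "decode M l x y = (\<lambda>i. if i \<prec>\<^bsub>M\<^esub> l then Some (beta M x y i) else None)"

definition is_seq :: "'m arith \<Rightarrow> 'm mseq \<Rightarrow> bool"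
  where "is_seq M s \<longleftrightarrow> (\<exists>l x y. s = decode M l x y)"

definition seqlen :: "'m arith \<Rightarrow> 'm mseq \<Rightarrow> 'm"
  where "seqlen M s = (THE l. dom s = below M l)"

text \<open>
  The cardinality in \<open>M\<close> of a set of sequences: the \<open>m\<close> for which some bijection with
  \<open>{i. i \<prec> m}\<close> is definable in \<open>M\<close>, where a map into sequences is definable if the relation
  between arguments and codes of values is.
\<close>

definition mcard :: "'m arith \<Rightarrow> 'm mseq set \<Rightarrow> 'm"
  where "mcard M X = (THE m. \<exists>F. bij_betw F (below M m) X \<and>
    definable M 4 (\<lambda>xs. xs ! 0 \<prec>\<^bsub>M\<^esub> m \<and> decode M (xs ! 1) (xs ! 2) (xs ! 3) = F (xs ! 0)))"

definition Oseqs :: "'m arith \<Rightarrow> 'm \<Rightarrow> 'm mseq set"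
  where "Oseqs M n = {s. is_seq M s \<and> inj_on s (dom s) \<and> ran s \<subseteq> below M n \<and>
    (\<exists>c::nat. seqlen M s \<preceq>\<^bsub>M\<^esub> spow M (bitlen M n) c)}"

definition seq_order :: "'m arith \<Rightarrow> 'm mseq \<Rightarrow> ('m \<times> 'm) set"
  where "seq_order M s = {(x, y). \<exists>i j. i \<prec>\<^bsub>M\<^esub> j \<and> s i = Some x \<and> s j = Some y}"

definition extends :: "'m arith \<Rightarrow> 'm mseq \<Rightarrow> 'm mseq \<Rightarrow> bool"
  where "extends M s' s \<longleftrightarrow> seq_order M s \<subseteq> seq_order M s'"

definition compatible :: "'m arith \<Rightarrow> 'm \<Rightarrow> 'm mseq \<Rightarrow> 'm mseq \<Rightarrow> bool"
  where "compatible M n s s' \<longleftrightarrow> (\<exists>t \<in> Oseqs M n. extends M t s \<and> extends M t s')"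

definition definable_family ::
    "'m arith \<Rightarrow> 'm \<Rightarrow> 'm \<Rightarrow> ('m \<Rightarrow> 'm \<Rightarrow> 'm mseq set) \<Rightarrow> bool"
  where "definable_family M p h A \<longleftrightarrow> definable M 5 (\<lambda>xs. xs ! 0 \<prec>\<^bsub>M\<^esub> p \<and> xs ! 1 \<prec>\<^bsub>M\<^esub> h \<and>
    decode M (xs ! 2) (xs ! 3) (xs ! 4) \<in> A (xs ! 0) (xs ! 1))"

text \<open>Only the cells \<open>A a b\<close> with \<open>a \<prec> p\<close> and \<open>b \<prec> h\<close> matter.\<close>

definition is_array ::
    "'m arith \<Rightarrow> 'm \<Rightarrow> 'm mseq \<Rightarrow> 'm \<Rightarrow> 'm \<Rightarrow> ('m \<Rightarrow> 'm \<Rightarrow> 'm mseq set) \<Rightarrow> bool"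
  where "is_array M n s p h A \<longleftrightarrow>
    s \<in> Oseqs M n \<and>
    definable_family M p h A \<and>
    (\<forall>a \<in> below M p. \<forall>b \<in> below M h. A a b \<subseteq> Oseqs M n) \<and>
    (\<forall>a \<in> below M p. \<forall>b \<in> below M h. \<forall>r \<in> A a b. extends M r s) \<and>
    (\<forall>a \<in> below M p. \<forall>b \<in> below M h. \<forall>r \<in> A a b. \<forall>r' \<in> A a b.
       r \<noteq> r' \<longrightarrow> \<not> compatible M n r r') \<and>
    (\<forall>a \<in> below M p. \<forall>a' \<in> below M p. \<forall>b \<in> below M h. a \<noteq> a' \<longrightarrow>
       (\<forall>r \<in> A a b. \<forall>r' \<in> A a' b. \<not> compatible M n r r')) \<and>
    (\<forall>a \<in> below M p. \<forall>b \<in> below M h. \<forall>b' \<in> below M h. b \<noteq> b' \<longrightarrow>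
       (\<forall>r \<in> A a b. \<forall>r' \<in> A a b'. \<not> compatible M n r r')) \<and>
    (\<forall>q \<in> Oseqs M n. extends M q s \<longrightarrow>
       (\<forall>a \<in> below M p. \<exists>b \<in> below M h. \<exists>r \<in> A a b. compatible M n q r))"

definition array_size ::
    "'m arith \<Rightarrow> 'm \<Rightarrow> 'm \<Rightarrow> ('m \<Rightarrow> 'm \<Rightarrow> 'm mseq set) \<Rightarrow> 'm"
  where "array_size M p h A = msum M (\<lambda>a. msum M (\<lambda>b. mcard M (A a b)) h) p"

end

theory Submission
  imports Defs "HOL-Number_Theory.Cong" "HOL-Combinatorics.Multiset_Permutations"
begin

text \<open>
  For a fixed column \<open>b\<close>, the elements of all cells \<open>A a b\<close> are pairwise incompatible, so a linear
  order of \<open>[0,\<dots>,n)\<close> extending \<open>s\<close> extends at most one of them. An element \<open>r\<close> is extended by a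
  fraction \<open>|s|!/|r|! \<ge> |s|!/(|s|+d)!\<close> of these orders, so the column has at most
  \<open>(|s|+d)!/|s|!\<close> elements. This argument is carried out in the standard model. For each formula
  defining \<open>A\<close>, the bound, with cardinalities, sums and factorials witnessed by beta codes, is a
  first-order sentence and thus transfers to \<open>M\<close>. There, induction and the pigeonhole principle
  for definable relations, which are transferred likewise, show that the witnessed values are the
  ones given by \<^const>\<open>mrec\<close> and \<^const>\<open>mcard\<close>.
\<close>

section \<open>Transfer between the standard model and a model of true arithmetic\<close>

text \<open>Two things stand in the way of one transferred sentence. \<open>mrec\<close> and
  \<open>mcard\<close> are descriptions over definable functions, which a formula cannot quantify
  over; and the cells are given by an arbitrary formula with possibly nonstandard parameters.
  Witnesses are therefore beta codes, which are elements of the model, and the parameters stay free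
  variables, so that universal closure covers all of them at once. In the standard model the same
  formula need not describe a family of sets of sequences, nor give the same answer on two codes of
  one sequence. Hence the hypothesis of the transferred statement has to list everything that the
  count uses, and coded cardinalities and sums have to make sense for arbitrary relations. Transfer
  yields only the existence of witnesses; that they are the described values is a separate
  uniqueness argument in \<open>M\<close>, where the formula does define the family.\<close>

fun rename_tm :: "(nat \<Rightarrow> nat) \<Rightarrow> tm \<Rightarrow> tm" where
  "rename_tm \<rho> (Var i) = Var (\<rho> i)"
| "rename_tm \<rho> Zero = Zero"
| "rename_tm \<rho> One = One"
| "rename_tm \<rho> (Add s t) = Add (rename_tm \<rho> s) (rename_tm \<rho> t)"
| "rename_tm \<rho> (Mul s t) = Mul (rename_tm \<rho> s) (rename_tm \<rho> t)"

fun rename_fm :: "(nat \<Rightarrow> nat) \<Rightarrow> fm \<Rightarrow> fm" where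
  "rename_fm \<rho> (Eq s t) = Eq (rename_tm \<rho> s) (rename_tm \<rho> t)"
| "rename_fm \<rho> (Less s t) = Less (rename_tm \<rho> s) (rename_tm \<rho> t)"
| "rename_fm \<rho> (Neg \<phi>) = Neg (rename_fm \<rho> \<phi>)"
| "rename_fm \<rho> (Conj \<phi> \<psi>) = Conj (rename_fm \<rho> \<phi>) (rename_fm \<rho> \<psi>)"
| "rename_fm \<rho> (Exi \<phi>) = Exi (rename_fm (case_nat 0 (\<lambda>i. Suc (\<rho> i))) \<phi>)"

lemma tval_rename: "tval M e (rename_tm \<rho> t) = tval M (\<lambda>i. e (\<rho> i)) t"
  by (induction t) auto

lemma sat_rename: "sat M e (rename_fm \<rho> \<phi>) \<longleftrightarrow> sat M (\<lambda>i. e (\<rho> i)) \<phi>"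
proof (induction \<phi> arbitrary: e \<rho>)
  case (Exi \<phi>)
  have "(\<lambda>i. case_nat v e (case_nat 0 (\<lambda>i. Suc (\<rho> i)) i)) = case_nat v (\<lambda>i. e (\<rho> i))" for v
    by (auto split: nat.split)
  then show ?case by (simp add: Exi)
qed (auto simp: tval_rename)

lemma tm_below_mono: "tm_below k t \<Longrightarrow> k \<le> k' \<Longrightarrow> tm_below k' t"
  by (induction t) auto

lemma fm_below_mono: "fm_below k \<phi> \<Longrightarrow> k \<le> k' \<Longrightarrow> fm_below k' \<phi>"
  by (induction \<phi> arbitrary: k k') (auto intro: tm_below_mono)

lemma tm_below_ex: "\<exists>k. tm_below k t"
proof (induction t)
  case (Add s t)
  then obtain j k where "tm_below j s" "tm_below k t" by blast
  then have "tm_below (max j k) (Add s t)" by (auto intro: tm_below_mono)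
  then show ?case by blast
next
  case (Mul s t)
  then obtain j k where "tm_below j s" "tm_below k t" by blast
  then have "tm_below (max j k) (Mul s t)" by (auto intro: tm_below_mono)
  then show ?case by blast
qed auto

lemma fm_below_ex: "\<exists>k. fm_below k \<phi>"
proof (induction \<phi>)
  case (Eq s t)
  obtain j k where "tm_below j s" "tm_below k t" using tm_below_ex by blast
  then have "fm_below (max j k) (Eq s t)" by (auto intro: tm_below_mono)
  then show ?case by blast
next
  case (Less s t)
  obtain j k where "tm_below j s" "tm_below k t" using tm_below_ex by blast
  then have "fm_below (max j k) (Less s t)" by (auto intro: tm_below_mono)
  then show ?case by blast
next
  case (Conj \<phi> \<psi>)
  then obtain j k where "fm_below j \<phi>" "fm_below k \<psi>" by blast
  then have "fm_below (max j k) (Conj \<phi> \<psi>)" by (auto intro: fm_below_mono)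
  then show ?case by blast
next
  case (Exi \<phi>)
  then obtain k where "fm_below k \<phi>" by blast
  then have "fm_below k (Exi \<phi>)" by (auto intro: fm_below_mono)
  then show ?case by blast
qed auto

definition Forall :: "fm \<Rightarrow> fm"
  where "Forall \<phi> = Neg (Exi (Neg \<phi>))"

lemma models_Forall: "models M (Forall \<phi>) \<longleftrightarrow> models M \<phi>"
proof -
  have "e = case_nat (e 0) (\<lambda>i. e (Suc i))" for e :: "nat \<Rightarrow> 'a"
    by (auto split: nat.split)
  then have "(\<forall>e v. P (case_nat v e)) \<longleftrightarrow> (\<forall>e. P e)" for P :: "(nat \<Rightarrow> 'a) \<Rightarrow> bool" by metis
  then show ?thesis by (simp add: models_def Forall_def)
qed

text \<open>Truth of all sentences is enough because \<open>models\<close> quantifies over every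
  assignment, so a universal closure has the same models as the formula itself.\<close>

lemma true_arithmetic_models:
  assumes "true_arithmetic M"
  shows "models nat_arith \<phi> \<Longrightarrow> models M \<phi>"
proof -
  assume nat: "models nat_arith \<phi>"
  obtain k where k: "fm_below k \<phi>" using fm_below_ex by blast
  \<comment> \<open>Each \<open>Forall\<close> binds one variable. Monotonicity covers the truncated
    case in which \<open>k - j\<close> is already 0.\<close>
  have "fm_below (k - j) ((Forall ^^ j) \<phi>)" for j
  proof (induction j)
    case (Suc j)
    then show ?case by (auto simp: Forall_def elim: fm_below_mono)
  qed (simp add: k)
  from this[of k] have "sentence ((Forall ^^ k) \<phi>)" by (simp add: sentence_def)
  moreover have "models nat_arith ((Forall ^^ j) \<phi>) \<longleftrightarrow> models nat_arith \<phi>" for j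
    by (induction j) (simp_all add: models_Forall)
  moreover have "models M ((Forall ^^ j) \<phi>) \<longleftrightarrow> models M \<phi>" for j
    by (induction j) (simp_all add: models_Forall)
  ultimately show "models M \<phi>" using assms nat unfolding true_arithmetic_def by blast
qed

text \<open>
  \<open>P\<close> and \<open>Q\<close> are the interpretations of one formula in the standard model and in \<open>M\<close>. Working
  with such pairs replaces writing formulas with de Bruijn indices by applying closure rules.
\<close>

definition codef :: "'m arith \<Rightarrow> ((nat \<Rightarrow> nat) \<Rightarrow> bool) \<Rightarrow> ((nat \<Rightarrow> 'm) \<Rightarrow> bool) \<Rightarrow> bool"
  where "codef M P Q \<longleftrightarrow> (\<exists>\<phi>. (\<forall>e. sat nat_arith e \<phi> \<longleftrightarrow> P e) \<and> (\<forall>e. sat M e \<phi> \<longleftrightarrow> Q e))"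

text \<open>Functions are handled through their graphs, with the value in variable 0, so that
  functions such as \<open>beta\<close>, which are not terms of the language, can be used like
  terms.\<close>

definition codef_fn :: "'m arith \<Rightarrow> ((nat \<Rightarrow> nat) \<Rightarrow> nat) \<Rightarrow> ((nat \<Rightarrow> 'm) \<Rightarrow> 'm) \<Rightarrow> bool"
  where "codef_fn M f g \<longleftrightarrow>
    codef M (\<lambda>e. e 0 = f (\<lambda>i. e (Suc i))) (\<lambda>e. e 0 = g (\<lambda>i. e (Suc i)))"

text \<open>The assignment \<open>e\<close> carries the parameters: proving \<open>P\<close> for
  every assignment in the standard model gives \<open>Q\<close> for parameters anywhere in
  \<open>M\<close>.\<close>

lemma codef_transfer:
  assumes "true_arithmetic M" "codef M P Q" "\<And>e. P e"
  shows "Q e"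
proof -
  obtain \<phi> where \<phi>: "\<forall>e. sat nat_arith e \<phi> \<longleftrightarrow> P e" "\<forall>e. sat M e \<phi> \<longleftrightarrow> Q e"
    using assms(2) unfolding codef_def by blast
  then have "models nat_arith \<phi>" by (simp add: models_def assms(3))
  then have "models M \<phi>" by (rule true_arithmetic_models[OF assms(1)])
  then show ?thesis using \<phi>(2) by (simp add: models_def)
qed

lemma codef_neg: "codef M P Q \<Longrightarrow> codef M (\<lambda>e. \<not> P e) (\<lambda>e. \<not> Q e)"
  unfolding codef_def by (elim exE, rule_tac x="Neg \<phi>" in exI) simp

lemma codef_conj:
  "codef M P Q \<Longrightarrow> codef M P' Q' \<Longrightarrow> codef M (\<lambda>e. P e \<and> P' e) (\<lambda>e. Q e \<and> Q' e)"
  unfolding codef_def by (elim exE, rule_tac x="Conj \<phi> \<phi>'" in exI) simp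

lemma codef_disj:
  assumes "codef M P Q" "codef M P' Q'"
  shows "codef M (\<lambda>e. P e \<or> P' e) (\<lambda>e. Q e \<or> Q' e)"
proof -
  have "codef M (\<lambda>e. \<not> (\<not> P e \<and> \<not> P' e)) (\<lambda>e. \<not> (\<not> Q e \<and> \<not> Q' e))"
    by (intro codef_neg codef_conj assms)
  then show ?thesis by simp
qed

lemma codef_imp:
  assumes "codef M P Q" "codef M P' Q'"
  shows "codef M (\<lambda>e. P e \<longrightarrow> P' e) (\<lambda>e. Q e \<longrightarrow> Q' e)"
  unfolding imp_conv_disj by (intro codef_disj codef_neg assms)

lemma codef_iff:
  assumes "codef M P Q" "codef M P' Q'"
  shows "codef M (\<lambda>e. P e \<longleftrightarrow> P' e) (\<lambda>e. Q e \<longleftrightarrow> Q' e)"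
  unfolding iff_conv_conj_imp by (intro codef_conj codef_imp assms)

lemma codef_ex:
  assumes "codef M (\<lambda>e. P (\<lambda>i. e (Suc i)) (e 0)) (\<lambda>e. Q (\<lambda>i. e (Suc i)) (e 0))"
  shows "codef M (\<lambda>e. \<exists>v. P e v) (\<lambda>e. \<exists>v. Q e v)"
proof -
  obtain \<phi> where "\<forall>e. sat nat_arith e \<phi> \<longleftrightarrow> P (\<lambda>i. e (Suc i)) (e 0)"
    "\<forall>e. sat M e \<phi> \<longleftrightarrow> Q (\<lambda>i. e (Suc i)) (e 0)"
    using assms unfolding codef_def by blast
  then have "(\<forall>e. sat nat_arith e (Exi \<phi>) \<longleftrightarrow> (\<exists>v. P e v)) \<and> (\<forall>e. sat M e (Exi \<phi>) \<longleftrightarrow> (\<exists>v. Q e v))"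
    by simp
  then show ?thesis unfolding codef_def by blast
qed

lemma codef_all:
  assumes "codef M (\<lambda>e. P (\<lambda>i. e (Suc i)) (e 0)) (\<lambda>e. Q (\<lambda>i. e (Suc i)) (e 0))"
  shows "codef M (\<lambda>e. \<forall>v. P e v) (\<lambda>e. \<forall>v. Q e v)"
proof -
  have "codef M (\<lambda>e. \<not> (\<exists>v. \<not> P e v)) (\<lambda>e. \<not> (\<exists>v. \<not> Q e v))"
    by (intro codef_neg codef_ex assms)
  then show ?thesis by simp
qed

lemma codef_rename:
  assumes "codef M P Q"
  shows "codef M (\<lambda>e. P (\<lambda>i. e (\<rho> i))) (\<lambda>e. Q (\<lambda>i. e (\<rho> i)))"
proof -
  obtain \<phi> where "\<forall>e. sat nat_arith e \<phi> \<longleftrightarrow> P e" "\<forall>e. sat M e \<phi> \<longleftrightarrow> Q e"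
    using assms unfolding codef_def by blast
  then show ?thesis
    unfolding codef_def by (intro exI[of _ "rename_fm \<rho> \<phi>"]) (simp add: sat_rename)
qed

lemma codef_fn_rename:
  assumes "codef_fn M f g"
  shows "codef_fn M (\<lambda>e. f (\<lambda>i. e (\<rho> i))) (\<lambda>e. g (\<lambda>i. e (\<rho> i)))"
  using codef_rename[OF assms[unfolded codef_fn_def], of "case_nat 0 (\<lambda>i. Suc (\<rho> i))"]
  by (simp add: codef_fn_def)

text \<open>Unnesting: a function value inside a formula is replaced by a quantified variable that
  satisfies the graph.\<close>

lemma codef_subst:
  assumes "codef M (\<lambda>e. P (\<lambda>i. e (Suc i)) (e 0)) (\<lambda>e. Q (\<lambda>i. e (Suc i)) (e 0))"
    and "codef_fn M f g"
  shows "codef M (\<lambda>e. P e (f e)) (\<lambda>e. Q e (g e))"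
proof -
  have "codef M (\<lambda>e. \<exists>v. v = f e \<and> P e v) (\<lambda>e. \<exists>v. v = g e \<and> Q e v)"
    by (intro codef_ex codef_conj assms(1) assms(2)[unfolded codef_fn_def])
  then show ?thesis by simp
qed

lemma codef_fn_subst:
  assumes "codef_fn M (\<lambda>e. F (\<lambda>i. e (Suc i)) (e 0)) (\<lambda>e. G (\<lambda>i. e (Suc i)) (e 0))"
    and "codef_fn M f g"
  shows "codef_fn M (\<lambda>e. F e (f e)) (\<lambda>e. G e (g e))"
proof -
  \<comment> \<open>The renaming exchanges variables 0 and 1: the graph of the outer function keeps
    its value in variable 0, but \<open>codef_subst\<close> substitutes for variable 0.\<close>
  have "codef M (\<lambda>e. e (Suc 0) = F (\<lambda>i. e (Suc (Suc i))) (e 0))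
      (\<lambda>e. e (Suc 0) = G (\<lambda>i. e (Suc (Suc i))) (e 0))"
    using codef_rename[OF assms(1)[unfolded codef_fn_def],
        of "case_nat (Suc 0) (case_nat 0 (\<lambda>i. Suc (Suc i)))"] by simp
  then show ?thesis
    unfolding codef_fn_def
    by (rule codef_subst[where P="\<lambda>e v. e 0 = F (\<lambda>i. e (Suc i)) v" and Q="\<lambda>e v. e 0 = G (\<lambda>i. e (Suc i)) v",
          OF _ codef_fn_rename[OF assms(2), of Suc]])
qed

lemma codef_tm:
  "codef M (\<lambda>e. tval nat_arith e s = tval nat_arith e t) (\<lambda>e. tval M e s = tval M e t)"
  "codef M (\<lambda>e. tval nat_arith e s \<prec>\<^bsub>nat_arith\<^esub> tval nat_arith e t) (\<lambda>e. tval M e s \<prec>\<^bsub>M\<^esub> tval M e t)"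
  unfolding codef_def by (rule exI[of _ "Eq s t"], simp) (rule exI[of _ "Less s t"], simp)

lemma codef_fn_tm: "codef_fn M (\<lambda>e. tval nat_arith e t) (\<lambda>e. tval M e t)"
  using codef_tm(1)[of M "Var 0" "rename_tm Suc t"] by (simp add: codef_fn_def tval_rename)

lemma codef_fn_var: "codef_fn M (\<lambda>e. e i) (\<lambda>e. e i)"
  using codef_fn_tm[of M "Var i"] by simp

lemma codef_fn_zero: "codef_fn M (\<lambda>e. \<zero>\<^bsub>nat_arith\<^esub>) (\<lambda>e. \<zero>\<^bsub>M\<^esub>)"
  using codef_fn_tm[of M Zero] by simp

lemma codef_fn_one: "codef_fn M (\<lambda>e. \<one>\<^bsub>nat_arith\<^esub>) (\<lambda>e. \<one>\<^bsub>M\<^esub>)"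
  using codef_fn_tm[of M One] by simp

lemma codef_binary:
  assumes "codef M (\<lambda>e. P (e 0) (e (Suc 0))) (\<lambda>e. Q (e 0) (e (Suc 0)))"
    and "codef_fn M f f'" "codef_fn M g g'"
  shows "codef M (\<lambda>e. P (f e) (g e)) (\<lambda>e. Q (f' e) (g' e))"
proof -
  have "codef M (\<lambda>e. P (e (Suc 0)) (e 0)) (\<lambda>e. Q (e (Suc 0)) (e 0))"
    using codef_rename[OF assms(1), of "case_nat (Suc 0) (\<lambda>_. 0)"] by simp
  then have "codef M (\<lambda>e. P (e 0) (g (\<lambda>i. e (Suc i)))) (\<lambda>e. Q (e 0) (g' (\<lambda>i. e (Suc i))))"
    by (rule codef_subst[where P="\<lambda>e v. P (e 0) v" and Q="\<lambda>e v. Q (e 0) v",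
          OF _ codef_fn_rename[OF assms(3), of Suc]])
  then show ?thesis
    by (rule codef_subst[where P="\<lambda>e v. P v (g e)" and Q="\<lambda>e v. Q v (g' e)", OF _ assms(2)])
qed

lemma codef_fn_binary:
  assumes "codef_fn M (\<lambda>e. F (e 0) (e (Suc 0))) (\<lambda>e. G (e 0) (e (Suc 0)))"
    and "codef_fn M f f'" "codef_fn M g g'"
  shows "codef_fn M (\<lambda>e. F (f e) (g e)) (\<lambda>e. G (f' e) (g' e))"
proof -
  have "codef_fn M (\<lambda>e. F (e (Suc 0)) (e 0)) (\<lambda>e. G (e (Suc 0)) (e 0))"
    using codef_fn_rename[OF assms(1), of "case_nat (Suc 0) (\<lambda>_. 0)"] by simp
  then have "codef_fn M (\<lambda>e. F (e 0) (g (\<lambda>i. e (Suc i)))) (\<lambda>e. G (e 0) (g' (\<lambda>i. e (Suc i))))"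
    by (rule codef_fn_subst[where F="\<lambda>e v. F (e 0) v" and G="\<lambda>e v. G (e 0) v",
          OF _ codef_fn_rename[OF assms(3), of Suc]])
  then show ?thesis
    by (rule codef_fn_subst[where F="\<lambda>e v. F v (g e)" and G="\<lambda>e v. G v (g' e)", OF _ assms(2)])
qed

lemma codef_eq:
  assumes "codef_fn M f f'" "codef_fn M g g'"
  shows "codef M (\<lambda>e. f e = g e) (\<lambda>e. f' e = g' e)"
proof -
  have "codef M (\<lambda>e. e 0 = e (Suc 0)) (\<lambda>e. e 0 = e (Suc 0))"
    using codef_tm(1)[of M "Var 0" "Var (Suc 0)"] by simp
  from codef_binary[OF this assms] show ?thesis .
qed

lemma codef_less:
  assumes "codef_fn M f f'" "codef_fn M g g'"
  shows "codef M (\<lambda>e. f e \<prec>\<^bsub>nat_arith\<^esub> g e) (\<lambda>e. f' e \<prec>\<^bsub>M\<^esub> g' e)"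
proof -
  have "codef M (\<lambda>e. e 0 \<prec>\<^bsub>nat_arith\<^esub> e (Suc 0)) (\<lambda>e. e 0 \<prec>\<^bsub>M\<^esub> e (Suc 0))"
    using codef_tm(2)[of M "Var 0" "Var (Suc 0)"] by simp
  from codef_binary[OF this assms] show ?thesis .
qed

lemma codef_le:
  assumes "codef_fn M f f'" "codef_fn M g g'"
  shows "codef M (\<lambda>e. f e \<preceq>\<^bsub>nat_arith\<^esub> g e) (\<lambda>e. f' e \<preceq>\<^bsub>M\<^esub> g' e)"
  unfolding le_def by (intro codef_disj codef_less codef_eq assms)

lemma codef_fn_add:
  assumes "codef_fn M f f'" "codef_fn M g g'"
  shows "codef_fn M (\<lambda>e. f e \<oplus>\<^bsub>nat_arith\<^esub> g e) (\<lambda>e. f' e \<oplus>\<^bsub>M\<^esub> g' e)"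
proof -
  have "codef_fn M (\<lambda>e. e 0 \<oplus>\<^bsub>nat_arith\<^esub> e (Suc 0)) (\<lambda>e. e 0 \<oplus>\<^bsub>M\<^esub> e (Suc 0))"
    using codef_fn_tm[of M "Add (Var 0) (Var (Suc 0))"] by simp
  from codef_fn_binary[OF this assms] show ?thesis .
qed

lemma codef_fn_mul:
  assumes "codef_fn M f f'" "codef_fn M g g'"
  shows "codef_fn M (\<lambda>e. f e \<otimes>\<^bsub>nat_arith\<^esub> g e) (\<lambda>e. f' e \<otimes>\<^bsub>M\<^esub> g' e)"
proof -
  have "codef_fn M (\<lambda>e. e 0 \<otimes>\<^bsub>nat_arith\<^esub> e (Suc 0)) (\<lambda>e. e 0 \<otimes>\<^bsub>M\<^esub> e (Suc 0))"
    using codef_fn_tm[of M "Mul (Var 0) (Var (Suc 0))"] by simp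
  from codef_fn_binary[OF this assms] show ?thesis .
qed

lemma codef_fn_tval:
  assumes "\<And>i. codef_fn M (\<lambda>e. F e i) (\<lambda>e. G e i)"
  shows "codef_fn M (\<lambda>e. tval nat_arith (F e) t) (\<lambda>e. tval M (G e) t)"
  by (induction t)
    (simp_all add: assms codef_fn_zero codef_fn_one codef_fn_add codef_fn_mul)

text \<open>This makes an unknown formula usable as an atom inside larger statements. The
  assignments vary in the induction because a quantifier pushes its bound variable onto
  them.\<close>

lemma codef_sat:
  assumes "\<And>i. codef_fn M (\<lambda>e. F e i) (\<lambda>e. G e i)"
  shows "codef M (\<lambda>e. sat nat_arith (F e) \<phi>) (\<lambda>e. sat M (G e) \<phi>)"
  using assms
proof (induction \<phi> arbitrary: F G)
  case (Exi \<phi>)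
  have "codef_fn M (\<lambda>e. case_nat (e 0) (F (\<lambda>i. e (Suc i))) i) (\<lambda>e. case_nat (e 0) (G (\<lambda>i. e (Suc i))) i)" for i
    by (cases i) (simp_all add: codef_fn_var codef_fn_rename[OF Exi.prems])
  from Exi.IH[OF this] show ?case
    unfolding sat.simps by (rule codef_ex)
qed (simp_all add: codef_fn_tval codef_eq codef_less codef_neg codef_conj)

lemmas codef_intros =
  codef_neg codef_conj codef_disj codef_imp codef_iff codef_ex codef_all
  codef_eq codef_less codef_le
  codef_fn_var codef_fn_zero codef_fn_one codef_fn_add codef_fn_mul

lemma nat_arith_simps [simp]:
  "\<zero>\<^bsub>nat_arith\<^esub> = 0" "\<one>\<^bsub>nat_arith\<^esub> = 1" "x \<oplus>\<^bsub>nat_arith\<^esub> y = x + y"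
  "x \<otimes>\<^bsub>nat_arith\<^esub> y = x * y" "x \<prec>\<^bsub>nat_arith\<^esub> y \<longleftrightarrow> x < y" "x \<preceq>\<^bsub>nat_arith\<^esub> y \<longleftrightarrow> x \<le> y"
  by (auto simp: nat_arith_def le_def)

definition prepend :: "'a list \<Rightarrow> (nat \<Rightarrow> 'a) \<Rightarrow> nat \<Rightarrow> 'a"
  where "prepend xs e i = (if i < length xs then xs ! i else e (i - length xs))"

text \<open>The listed functions fill the first variables and the rest are parameters. Every
  enclosing quantifier shifts the parameters by one, and \<open>\<rho>\<close> absorbs these shifts;
  this is why later statements write the parameters as \<open>\<lambda>i. e i\<close>.\<close>

lemma codef_sat_prepend:
  assumes "list_all2 (codef_fn M) fs gs"
  shows "codef M (\<lambda>e. sat nat_arith (prepend (map (\<lambda>f. f e) fs) (\<lambda>i. e (\<rho> i))) \<phi>)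
    (\<lambda>e. sat M (prepend (map (\<lambda>g. g e) gs) (\<lambda>i. e (\<rho> i))) \<phi>)"
proof (rule codef_sat)
  fix i
  have len: "length fs = length gs" using assms by (rule list_all2_lengthD)
  show "codef_fn M (\<lambda>e. prepend (map (\<lambda>f. f e) fs) (\<lambda>i. e (\<rho> i)) i)
      (\<lambda>e. prepend (map (\<lambda>g. g e) gs) (\<lambda>i. e (\<rho> i)) i)"
  proof (cases "i < length fs")
    case True
    then show ?thesis using len list_all2_nthD[OF assms True] by (simp add: prepend_def)
  next
    case False
    then show ?thesis using len by (simp add: prepend_def codef_fn_var)
  qed
qed

lemma codef_sat2:
  assumes "codef_fn M f1 g1" "codef_fn M f2 g2"
  shows "codef M (\<lambda>e. sat nat_arith (prepend [f1 e, f2 e] (\<lambda>i. e (\<rho> i))) \<phi>)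
    (\<lambda>e. sat M (prepend [g1 e, g2 e] (\<lambda>i. e (\<rho> i))) \<phi>)"
  using codef_sat_prepend[of M "[f1, f2]" "[g1, g2]"] assms by simp

lemma codef_sat4:
  assumes "codef_fn M f1 g1" "codef_fn M f2 g2" "codef_fn M f3 g3" "codef_fn M f4 g4"
  shows "codef M (\<lambda>e. sat nat_arith (prepend [f1 e, f2 e, f3 e, f4 e] (\<lambda>i. e (\<rho> i))) \<phi>)
    (\<lambda>e. sat M (prepend [g1 e, g2 e, g3 e, g4 e] (\<lambda>i. e (\<rho> i))) \<phi>)"
  using codef_sat_prepend[of M "[f1, f2, f3, f4]" "[g1, g2, g3, g4]"] assms by simp

lemma codef_sat5:
  assumes "codef_fn M f1 g1" "codef_fn M f2 g2" "codef_fn M f3 g3" "codef_fn M f4 g4"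
    "codef_fn M f5 g5"
  shows "codef M (\<lambda>e. sat nat_arith (prepend [f1 e, f2 e, f3 e, f4 e, f5 e] (\<lambda>i. e (\<rho> i))) \<phi>)
    (\<lambda>e. sat M (prepend [g1 e, g2 e, g3 e, g4 e, g5 e] (\<lambda>i. e (\<rho> i))) \<phi>)"
  using codef_sat_prepend[of M "[f1, f2, f3, f4, f5]" "[g1, g2, g3, g4, g5]"] assms by simp

lemma definable_iff_prepend:
  "definable M k R \<longleftrightarrow> (\<exists>\<phi> e. \<forall>xs. length xs = k \<longrightarrow> (R xs \<longleftrightarrow> sat M (prepend xs e) \<phi>))"
proof -
  have "(\<lambda>i. if i < k then xs ! i else e (i - k)) = prepend xs e" if "length xs = k" for xs :: "'a list" and e
    using that by (auto simp: prepend_def)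
  then show ?thesis unfolding definable_def by (simp cong: imp_cong)
qed

lemma codef_imp_definable:
  assumes "codef M P Q"
  shows "definable M k (\<lambda>xs. Q (prepend xs e))"
proof -
  obtain \<phi> where "\<forall>e. sat M e \<phi> \<longleftrightarrow> Q e" using assms unfolding codef_def by blast
  then show ?thesis
    unfolding definable_iff_prepend by (intro exI[of _ \<phi>] exI[of _ e]) simp
qed

text \<open>All assumptions are first-order, so the locale predicate is itself a sentence and passes
  to \<open>M\<close> in one transfer. Having both structures as instances also lets consequences
  such as the graph of \<open>beta\<close> be used on both sides of a \<open>codef\<close>
  pair.\<close>

locale basic_arithmetic =
  fixes M :: "'m arith"
  assumes less_irrefl: "\<not> x \<prec>\<^bsub>M\<^esub> x"
    and less_total: "x \<prec>\<^bsub>M\<^esub> y \<or> x = y \<or> y \<prec>\<^bsub>M\<^esub> x"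
    and le_trans: "x \<preceq>\<^bsub>M\<^esub> y \<Longrightarrow> y \<preceq>\<^bsub>M\<^esub> z \<Longrightarrow> x \<preceq>\<^bsub>M\<^esub> z"
    and less_add_right: "i \<prec>\<^bsub>M\<^esub> x \<Longrightarrow> i \<prec>\<^bsub>M\<^esub> x \<oplus>\<^bsub>M\<^esub> y"
    and add_mono: "x \<preceq>\<^bsub>M\<^esub> u \<Longrightarrow> y \<preceq>\<^bsub>M\<^esub> v \<Longrightarrow> x \<oplus>\<^bsub>M\<^esub> y \<preceq>\<^bsub>M\<^esub> u \<oplus>\<^bsub>M\<^esub> v"
    and add_zero: "x \<oplus>\<^bsub>M\<^esub> \<zero>\<^bsub>M\<^esub> = x"
    and le_mul: "\<one>\<^bsub>M\<^esub> \<oplus>\<^bsub>M\<^esub> \<one>\<^bsub>M\<^esub> \<preceq>\<^bsub>M\<^esub> x \<Longrightarrow> v \<preceq>\<^bsub>M\<^esub> x \<otimes>\<^bsub>M\<^esub> v"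
    and double_le_mul: "\<one>\<^bsub>M\<^esub> \<oplus>\<^bsub>M\<^esub> \<one>\<^bsub>M\<^esub> \<preceq>\<^bsub>M\<^esub> x \<Longrightarrow> v \<oplus>\<^bsub>M\<^esub> v \<preceq>\<^bsub>M\<^esub> x \<otimes>\<^bsub>M\<^esub> v"
    and mul_le_one: "x \<prec>\<^bsub>M\<^esub> \<one>\<^bsub>M\<^esub> \<oplus>\<^bsub>M\<^esub> \<one>\<^bsub>M\<^esub> \<Longrightarrow> v \<preceq>\<^bsub>M\<^esub> \<one>\<^bsub>M\<^esub> \<Longrightarrow> x \<otimes>\<^bsub>M\<^esub> v \<preceq>\<^bsub>M\<^esub> \<one>\<^bsub>M\<^esub>"
    and no_pair_below_one: "l \<preceq>\<^bsub>M\<^esub> \<one>\<^bsub>M\<^esub> \<Longrightarrow> i \<prec>\<^bsub>M\<^esub> j \<Longrightarrow> \<not> j \<prec>\<^bsub>M\<^esub> l"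
    and div_exists: "\<exists>q r. r \<prec>\<^bsub>M\<^esub> \<one>\<^bsub>M\<^esub> \<oplus>\<^bsub>M\<^esub> y \<and> x = q \<otimes>\<^bsub>M\<^esub> (\<one>\<^bsub>M\<^esub> \<oplus>\<^bsub>M\<^esub> y) \<oplus>\<^bsub>M\<^esub> r"
    and div_unique: "r \<prec>\<^bsub>M\<^esub> y \<Longrightarrow> r' \<prec>\<^bsub>M\<^esub> y \<Longrightarrow> q \<otimes>\<^bsub>M\<^esub> y \<oplus>\<^bsub>M\<^esub> r = q' \<otimes>\<^bsub>M\<^esub> y \<oplus>\<^bsub>M\<^esub> r' \<Longrightarrow> q = q' \<and> r = r'"

lemma basic_arithmetic_nat: "basic_arithmetic nat_arith"
proof
  fix x v :: nat
  assume "\<one>\<^bsub>nat_arith\<^esub> \<oplus>\<^bsub>nat_arith\<^esub> \<one>\<^bsub>nat_arith\<^esub> \<preceq>\<^bsub>nat_arith\<^esub> x"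
  then have "2 \<le> x" by simp
  from mult_le_mono1[OF this, of v] have "v + v \<le> x * v" by (simp only: mult_2)
  then show "v \<preceq>\<^bsub>nat_arith\<^esub> x \<otimes>\<^bsub>nat_arith\<^esub> v"
    "v \<oplus>\<^bsub>nat_arith\<^esub> v \<preceq>\<^bsub>nat_arith\<^esub> x \<otimes>\<^bsub>nat_arith\<^esub> v"
    unfolding nat_arith_simps by linarith+
next
  fix x v :: nat
  assume "x \<prec>\<^bsub>nat_arith\<^esub> \<one>\<^bsub>nat_arith\<^esub> \<oplus>\<^bsub>nat_arith\<^esub> \<one>\<^bsub>nat_arith\<^esub>" "v \<preceq>\<^bsub>nat_arith\<^esub> \<one>\<^bsub>nat_arith\<^esub>"
  then have "x \<le> 1" "v \<le> 1" by simp_all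
  then show "x \<otimes>\<^bsub>nat_arith\<^esub> v \<preceq>\<^bsub>nat_arith\<^esub> \<one>\<^bsub>nat_arith\<^esub>"
    using mult_le_mono[of x 1 v 1] by simp
next
  fix x y :: nat
  have "x = x div (1 + y) * (1 + y) + x mod (1 + y)" by (rule div_mult_mod_eq[symmetric])
  moreover have "x mod (1 + y) < 1 + y" by simp
  ultimately show "\<exists>q r. r \<prec>\<^bsub>nat_arith\<^esub> \<one>\<^bsub>nat_arith\<^esub> \<oplus>\<^bsub>nat_arith\<^esub> y \<and>
      x = q \<otimes>\<^bsub>nat_arith\<^esub> (\<one>\<^bsub>nat_arith\<^esub> \<oplus>\<^bsub>nat_arith\<^esub> y) \<oplus>\<^bsub>nat_arith\<^esub> r"
    unfolding nat_arith_simps by blast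
next
  fix r y r' q q' :: nat
  assume "r \<prec>\<^bsub>nat_arith\<^esub> y" "r' \<prec>\<^bsub>nat_arith\<^esub> y"
    "q \<otimes>\<^bsub>nat_arith\<^esub> y \<oplus>\<^bsub>nat_arith\<^esub> r = q' \<otimes>\<^bsub>nat_arith\<^esub> y \<oplus>\<^bsub>nat_arith\<^esub> r'"
  then have *: "r < y" "r' < y" "q * y + r = q' * y + r'" by simp_all
  have "(q * y + r) div y = q" "(q' * y + r') div y = q'" using *(1,2) by simp_all
  then have "q = q'" using *(3) by metis
  then show "q = q' \<and> r = r'" using * by simp
qed auto

locale arithmetic_model =
  fixes M :: "'m arith"
  assumes true_arithmetic: "true_arithmetic M"
begin

lemmas transfer = codef_transfer[OF true_arithmetic]

lemma transfer_sentence: "codef M (\<lambda>_. P) (\<lambda>_. Q) \<Longrightarrow> P \<Longrightarrow> Q"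
  by (rule transfer)

end

sublocale arithmetic_model \<subseteq> basic_arithmetic M
proof (rule transfer_sentence[OF _ basic_arithmetic_nat])
  show "codef M (\<lambda>_. basic_arithmetic nat_arith) (\<lambda>_. basic_arithmetic M)"
    unfolding basic_arithmetic_def by (intro codef_intros)
qed

section \<open>Coded sequences, recursion and cardinality inside the model\<close>

context basic_arithmetic
begin

text \<open>Division with remainder makes the description in \<open>mmod\<close> proper, so that it
  can be traded for a first-order graph. The modulus is a successor, hence never zero.\<close>

lemma beta_eq_iff:
  "v = beta M x y i \<longleftrightarrow>
    v \<prec>\<^bsub>M\<^esub> \<one>\<^bsub>M\<^esub> \<oplus>\<^bsub>M\<^esub> (i \<oplus>\<^bsub>M\<^esub> \<one>\<^bsub>M\<^esub>) \<otimes>\<^bsub>M\<^esub> y \<and>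
    (\<exists>q. x = q \<otimes>\<^bsub>M\<^esub> (\<one>\<^bsub>M\<^esub> \<oplus>\<^bsub>M\<^esub> (i \<oplus>\<^bsub>M\<^esub> \<one>\<^bsub>M\<^esub>) \<otimes>\<^bsub>M\<^esub> y) \<oplus>\<^bsub>M\<^esub> v)"
proof -
  let ?D = "\<one>\<^bsub>M\<^esub> \<oplus>\<^bsub>M\<^esub> (i \<oplus>\<^bsub>M\<^esub> \<one>\<^bsub>M\<^esub>) \<otimes>\<^bsub>M\<^esub> y"
  let ?R = "\<lambda>r. r \<prec>\<^bsub>M\<^esub> ?D \<and> (\<exists>q. x = q \<otimes>\<^bsub>M\<^esub> ?D \<oplus>\<^bsub>M\<^esub> r)"
  have uniq: "\<exists>!r. ?R r"
  proof (rule ex_ex1I)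
    show "\<exists>r. ?R r" using div_exists[of "(i \<oplus>\<^bsub>M\<^esub> \<one>\<^bsub>M\<^esub>) \<otimes>\<^bsub>M\<^esub> y" x] by blast
    show "r = r'" if R: "?R r" "?R r'" for r r'
    proof -
      from R obtain q q' where "q \<otimes>\<^bsub>M\<^esub> ?D \<oplus>\<^bsub>M\<^esub> r = q' \<otimes>\<^bsub>M\<^esub> ?D \<oplus>\<^bsub>M\<^esub> r'" by auto
      with R show ?thesis using div_unique by blast
    qed
  qed
  have "?R (beta M x y i)"
    unfolding beta_def mmod_def by (rule theI'[OF uniq])
  with uniq show ?thesis by blast
qed

lemma mdiv_exact:
  assumes "\<zero>\<^bsub>M\<^esub> \<prec>\<^bsub>M\<^esub> y"
  shows "mdiv M (q \<otimes>\<^bsub>M\<^esub> y) y = q"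
  unfolding mdiv_def
proof (rule the_equality)
  show "\<exists>r. r \<prec>\<^bsub>M\<^esub> y \<and> q \<otimes>\<^bsub>M\<^esub> y = q \<otimes>\<^bsub>M\<^esub> y \<oplus>\<^bsub>M\<^esub> r"
    using assms by (intro exI[of _ "\<zero>\<^bsub>M\<^esub>"]) (simp add: add_zero)
next
  fix q'
  assume "\<exists>r. r \<prec>\<^bsub>M\<^esub> y \<and> q \<otimes>\<^bsub>M\<^esub> y = q' \<otimes>\<^bsub>M\<^esub> y \<oplus>\<^bsub>M\<^esub> r"
  then obtain r where r: "r \<prec>\<^bsub>M\<^esub> y" "q \<otimes>\<^bsub>M\<^esub> y \<oplus>\<^bsub>M\<^esub> \<zero>\<^bsub>M\<^esub> = q' \<otimes>\<^bsub>M\<^esub> y \<oplus>\<^bsub>M\<^esub> r"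
    by (auto simp: add_zero)
  from div_unique[OF assms r] show "q' = q" by simp
qed

lemma below_inject: "below M x = below M y \<longleftrightarrow> x = y"
  using less_irrefl less_total[of x y] unfolding below_def set_eq_iff mem_Collect_eq by blast

lemma seqlen_decode: "seqlen M (decode M l x y) = l"
proof -
  have "dom (decode M l x y) = below M l" by (auto simp: decode_def below_def split: if_splits)
  then show ?thesis by (simp add: seqlen_def below_inject)
qed

end

lemma beta_nat: "beta nat_arith x y i = x mod (1 + (i + 1) * y)"
proof -
  interpret basic_arithmetic nat_arith by (rule basic_arithmetic_nat)
  have "x mod (1 + (i + 1) * y) = beta nat_arith x y i"
    unfolding beta_eq_iff nat_arith_simps
    by (intro conjI exI[of _ "x div (1 + (i + 1) * y)"] div_mult_mod_eq[symmetric]) simp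
  then show ?thesis by (rule sym)
qed

context arithmetic_model
begin

lemma codef_fn_beta:
  assumes "codef_fn M f f'" "codef_fn M g g'" "codef_fn M h h'"
  shows "codef_fn M (\<lambda>e. beta nat_arith (f e) (g e) (h e)) (\<lambda>e. beta M (f' e) (g' e) (h' e))"
proof -
  interpret nat: basic_arithmetic nat_arith by (rule basic_arithmetic_nat)
  \<comment> \<open>The value of \<open>beta\<close> occupies one variable and the quotient
    \<open>q\<close> another, so the arguments occur under one shift and under two.\<close>
  note shift = assms[THEN codef_fn_rename, of Suc] assms[THEN codef_fn_rename, of "\<lambda>i. Suc (Suc i)"]
  show ?thesis
    unfolding codef_fn_def nat.beta_eq_iff beta_eq_iff by (intro codef_intros shift)
qed

text \<open>A code solving the recursion up to \<open>k\<close> is itself a definable solution. Any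
  other definable solution \<open>S\<close> agrees with it by induction in \<open>M\<close> on the
  formula defining the graph of \<open>S\<close>.\<close>

lemma mrec_eq:
  assumes "beta M x y \<zero>\<^bsub>M\<^esub> = z"
    and step: "\<And>i. i \<prec>\<^bsub>M\<^esub> k \<Longrightarrow> beta M x y (i \<oplus>\<^bsub>M\<^esub> \<one>\<^bsub>M\<^esub>) = g i (beta M x y i)"
  shows "mrec M z g k = beta M x y k"
  unfolding mrec_def
proof (rule the_equality)
  have "codef M (\<lambda>e. e 1 = beta nat_arith (e 2) (e 3) (e 0)) (\<lambda>e. e 1 = beta M (e 2) (e 3) (e 0))"
    by (intro codef_intros codef_fn_beta)
  from codef_imp_definable[OF this, of 2 "case_nat x (\<lambda>_. y)"]
  have "definable M 2 (\<lambda>xs. xs ! 1 = beta M x y (xs ! 0))"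
    unfolding definable_def by (simp add: prepend_def numeral_eq_Suc cong: imp_cong)
  then show "\<exists>S. definable M 2 (\<lambda>xs. xs ! 1 = S (xs ! 0)) \<and> S \<zero>\<^bsub>M\<^esub> = z \<and>
      (\<forall>i\<in>below M k. S (i \<oplus>\<^bsub>M\<^esub> \<one>\<^bsub>M\<^esub>) = g i (S i)) \<and> S k = beta M x y k"
    using assms by (intro exI[of _ "beta M x y"]) (simp add: below_def)
next
  fix v
  assume "\<exists>S. definable M 2 (\<lambda>xs. xs ! 1 = S (xs ! 0)) \<and> S \<zero>\<^bsub>M\<^esub> = z \<and>
      (\<forall>i\<in>below M k. S (i \<oplus>\<^bsub>M\<^esub> \<one>\<^bsub>M\<^esub>) = g i (S i)) \<and> S k = v"
  then obtain S where S: "definable M 2 (\<lambda>xs. xs ! 1 = S (xs ! 0))" "S \<zero>\<^bsub>M\<^esub> = z"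
    "\<And>i. i \<prec>\<^bsub>M\<^esub> k \<Longrightarrow> S (i \<oplus>\<^bsub>M\<^esub> \<one>\<^bsub>M\<^esub>) = g i (S i)" "S k = v"
    by (auto simp: below_def)
  from S(1) obtain \<phi> e where
    "\<forall>xs. length xs = 2 \<longrightarrow> (xs ! 1 = S (xs ! 0) \<longleftrightarrow> sat M (prepend xs e) \<phi>)"
    unfolding definable_iff_prepend by blast
  then have graph: "sat M (prepend [i, w] e) \<phi> \<longleftrightarrow> w = S i" for i w
    by (auto dest: spec[of _ "[i, w]"])
  \<comment> \<open>In the standard model \<open>\<phi>\<close> need not be the graph of a function,
    so what is transferred is bare induction for the property that \<open>\<phi>\<close> holds of
    \<open>i\<close> and \<open>beta x y i\<close>. Only in \<open>M\<close> does
    \<open>graph\<close> read this as agreement with \<open>S\<close>.\<close>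
  have "codef M
    (\<lambda>e. \<forall>x y k. sat nat_arith (prepend [\<zero>\<^bsub>nat_arith\<^esub>, beta nat_arith x y \<zero>\<^bsub>nat_arith\<^esub>] (\<lambda>i. e i)) \<phi> \<longrightarrow>
      (\<forall>i. i \<prec>\<^bsub>nat_arith\<^esub> k \<longrightarrow> sat nat_arith (prepend [i, beta nat_arith x y i] (\<lambda>i. e i)) \<phi> \<longrightarrow>
        sat nat_arith (prepend [i \<oplus>\<^bsub>nat_arith\<^esub> \<one>\<^bsub>nat_arith\<^esub>,
          beta nat_arith x y (i \<oplus>\<^bsub>nat_arith\<^esub> \<one>\<^bsub>nat_arith\<^esub>)] (\<lambda>i. e i)) \<phi>) \<longrightarrow>
      sat nat_arith (prepend [k, beta nat_arith x y k] (\<lambda>i. e i)) \<phi>)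
    (\<lambda>e. \<forall>x y k. sat M (prepend [\<zero>\<^bsub>M\<^esub>, beta M x y \<zero>\<^bsub>M\<^esub>] (\<lambda>i. e i)) \<phi> \<longrightarrow>
      (\<forall>i. i \<prec>\<^bsub>M\<^esub> k \<longrightarrow> sat M (prepend [i, beta M x y i] (\<lambda>i. e i)) \<phi> \<longrightarrow>
        sat M (prepend [i \<oplus>\<^bsub>M\<^esub> \<one>\<^bsub>M\<^esub>, beta M x y (i \<oplus>\<^bsub>M\<^esub> \<one>\<^bsub>M\<^esub>)] (\<lambda>i. e i)) \<phi>) \<longrightarrow>
      sat M (prepend [k, beta M x y k] (\<lambda>i. e i)) \<phi>)"
    (is "codef M ?N _")
    by (intro codef_intros codef_fn_beta codef_sat2)
  moreover have "?N e" for e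
  proof (intro allI impI)
    fix x y k :: nat
    let ?P = "\<lambda>i. sat nat_arith (prepend [i, beta nat_arith x y i] (\<lambda>i. e i)) \<phi>"
    assume "?P \<zero>\<^bsub>nat_arith\<^esub>" "\<forall>i. i \<prec>\<^bsub>nat_arith\<^esub> k \<longrightarrow> ?P i \<longrightarrow> ?P (i \<oplus>\<^bsub>nat_arith\<^esub> \<one>\<^bsub>nat_arith\<^esub>)"
    then have "i \<le> k \<Longrightarrow> ?P i" for i by (induction i) auto
    then show "?P k" by simp
  qed
  ultimately have "\<forall>x y k. beta M x y \<zero>\<^bsub>M\<^esub> = S \<zero>\<^bsub>M\<^esub> \<longrightarrow>
      (\<forall>i. i \<prec>\<^bsub>M\<^esub> k \<longrightarrow> beta M x y i = S i \<longrightarrow>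
        beta M x y (i \<oplus>\<^bsub>M\<^esub> \<one>\<^bsub>M\<^esub>) = S (i \<oplus>\<^bsub>M\<^esub> \<one>\<^bsub>M\<^esub>)) \<longrightarrow> beta M x y k = S k"
    unfolding graph[symmetric] by (rule transfer)
  then show "v = beta M x y k" using S assms by metis
qed

end

text \<open>A relation is used instead of a function because \<open>Q\<close> is later a formula,
  about which nothing is known in the standard model; functionality has to be part of the
  condition.\<close>

definition bijective_relation :: "'m arith \<Rightarrow> 'm \<Rightarrow> 'm \<Rightarrow> ('m \<Rightarrow> 'm \<Rightarrow> bool) \<Rightarrow> bool"
  where "bijective_relation M m m' Q \<longleftrightarrow>
    (\<forall>i. i \<prec>\<^bsub>M\<^esub> m \<longrightarrow> (\<exists>j. j \<prec>\<^bsub>M\<^esub> m' \<and> Q i j)) \<and>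
    (\<forall>j. j \<prec>\<^bsub>M\<^esub> m' \<longrightarrow> (\<exists>i. i \<prec>\<^bsub>M\<^esub> m \<and> Q i j)) \<and>
    (\<forall>i i' j. i \<prec>\<^bsub>M\<^esub> m \<longrightarrow> i' \<prec>\<^bsub>M\<^esub> m \<longrightarrow> j \<prec>\<^bsub>M\<^esub> m' \<longrightarrow> Q i j \<longrightarrow> Q i' j \<longrightarrow> i = i') \<and>
    (\<forall>i j j'. i \<prec>\<^bsub>M\<^esub> m \<longrightarrow> j \<prec>\<^bsub>M\<^esub> m' \<longrightarrow> j' \<prec>\<^bsub>M\<^esub> m' \<longrightarrow> Q i j \<longrightarrow> Q i j' \<longrightarrow> j = j')"

lemma bijective_relation_nat:
  assumes "bijective_relation nat_arith m m' Q"
  shows "m = m'"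
proof -
  note B = assms[unfolded bijective_relation_def nat_arith_simps]
  obtain f where f: "\<And>i. i < m \<Longrightarrow> f i < m' \<and> Q i (f i)" using B by metis
  have "bij_betw f {..<m} {..<m'}"
  proof (rule bij_betwI')
    fix i j assume "i \<in> {..<m}" "j \<in> {..<m}"
    then show "f i = f j \<longleftrightarrow> i = j" using f[of i] f[of j] B by (metis lessThan_iff)
  next
    fix i assume "i \<in> {..<m}"
    then show "f i \<in> {..<m'}" using f by simp
  next
    fix j assume "j \<in> {..<m'}"
    then obtain i where "i < m" "j < m'" "Q i j" using B by auto
    then show "\<exists>i\<in>{..<m}. j = f i" using f[of i] B by (metis lessThan_iff)
  qed
  from bij_betw_same_card[OF this] show ?thesis by simp
qed

text \<open>A sequence is given by a triple, so an enumeration of sequences takes three beta codes,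
  one for each component.\<close>

definition coded_enum :: "'m arith \<Rightarrow> 'm \<Rightarrow> 'm \<Rightarrow> 'm \<Rightarrow> 'm \<Rightarrow> 'm \<Rightarrow> 'm \<Rightarrow> 'm \<Rightarrow> 'm mseq"
  where "coded_enum M x1 y1 x2 y2 x3 y3 i =
    decode M (beta M x1 y1 i) (beta M x2 y2 i) (beta M x3 y3 i)"

text \<open>Makes extensional equality of sequences first-order, although a sequence has many
  codes.\<close>

lemma decode_eq_iff:
  "decode M l x y = decode M l' x' y' \<longleftrightarrow>
    (\<forall>i. (i \<prec>\<^bsub>M\<^esub> l \<longleftrightarrow> i \<prec>\<^bsub>M\<^esub> l') \<and> (i \<prec>\<^bsub>M\<^esub> l \<longrightarrow> beta M x y i = beta M x' y' i))"
  unfolding decode_def fun_eq_iff by (auto split: if_splits)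

context arithmetic_model
begin

text \<open>The enumeration is definable from its codes, so \<open>m\<close> qualifies. For another
  definable bijection \<open>F\<close> from \<open>below M m'\<close>, matching equal values gives a
  definable bijection between the numbers below \<open>m\<close> and those below \<open>m'\<close>,
  and the transferred pigeonhole principle yields \<open>m = m'\<close>.\<close>

lemma mcard_eq:
  assumes bij: "bij_betw (coded_enum M x1 y1 x2 y2 x3 y3) (below M m) X"
  shows "mcard M X = m"
  unfolding mcard_def
proof (rule the_equality)
  have "codef M (\<lambda>e. e 0 \<prec>\<^bsub>nat_arith\<^esub> e 4 \<and> decode nat_arith (e 1) (e 2) (e 3) =
        decode nat_arith (beta nat_arith (e 5) (e 6) (e 0)) (beta nat_arith (e 7) (e 8) (e 0))
          (beta nat_arith (e 9) (e 10) (e 0)))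
      (\<lambda>e. e 0 \<prec>\<^bsub>M\<^esub> e 4 \<and> decode M (e 1) (e 2) (e 3) =
        decode M (beta M (e 5) (e 6) (e 0)) (beta M (e 7) (e 8) (e 0)) (beta M (e 9) (e 10) (e 0)))"
    unfolding decode_eq_iff by (intro codef_intros codef_fn_beta)
  from codef_imp_definable[OF this, of 4 "(!) [m, x1, y1, x2, y2, x3, y3]"]
  have "definable M 4 (\<lambda>xs. xs ! 0 \<prec>\<^bsub>M\<^esub> m \<and>
      decode M (xs ! 1) (xs ! 2) (xs ! 3) = coded_enum M x1 y1 x2 y2 x3 y3 (xs ! 0))"
    unfolding definable_def by (simp add: prepend_def coded_enum_def cong: imp_cong)
  with bij show "\<exists>F. bij_betw F (below M m) X \<and> definable M 4 (\<lambda>xs. xs ! 0 \<prec>\<^bsub>M\<^esub> m \<and>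
      decode M (xs ! 1) (xs ! 2) (xs ! 3) = F (xs ! 0))"
    by blast
next
  fix m'
  assume "\<exists>F. bij_betw F (below M m') X \<and> definable M 4 (\<lambda>xs. xs ! 0 \<prec>\<^bsub>M\<^esub> m' \<and>
      decode M (xs ! 1) (xs ! 2) (xs ! 3) = F (xs ! 0))"
  then obtain F \<phi> e where F: "bij_betw F (below M m') X" and
    "\<forall>xs. length xs = 4 \<longrightarrow> (xs ! 0 \<prec>\<^bsub>M\<^esub> m' \<and>
      decode M (xs ! 1) (xs ! 2) (xs ! 3) = F (xs ! 0) \<longleftrightarrow> sat M (prepend xs e) \<phi>)"
    unfolding definable_iff_prepend by blast
  then have graph: "sat M (prepend [j, l, x, y] e) \<phi> \<longleftrightarrow> j \<prec>\<^bsub>M\<^esub> m' \<and> decode M l x y = F j" for j l x y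
    by (auto dest: spec[of _ "[j, l, x, y]"])
  have "codef M
    (\<lambda>e. \<forall>x1 y1 x2 y2 x3 y3 m m'. bijective_relation nat_arith m m'
        (\<lambda>i j. sat nat_arith (prepend [j, beta nat_arith x1 y1 i, beta nat_arith x2 y2 i,
          beta nat_arith x3 y3 i] (\<lambda>k. e k)) \<phi>) \<longrightarrow> m = m')
    (\<lambda>e. \<forall>x1 y1 x2 y2 x3 y3 m m'. bijective_relation M m m'
        (\<lambda>i j. sat M (prepend [j, beta M x1 y1 i, beta M x2 y2 i, beta M x3 y3 i] (\<lambda>k. e k)) \<phi>) \<longrightarrow>
      m = m')"
    (is "codef M ?N ?M")
    unfolding bijective_relation_def by (intro codef_intros codef_fn_beta codef_sat4)
  then have "?M e" by (rule transfer) (intro allI impI, rule bijective_relation_nat)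
  then have "bijective_relation M m m' (\<lambda>i j. j \<prec>\<^bsub>M\<^esub> m' \<and> coded_enum M x1 y1 x2 y2 x3 y3 i = F j) \<Longrightarrow> m = m'"
    unfolding graph coded_enum_def by blast
  moreover have "bijective_relation M m m' (\<lambda>i j. j \<prec>\<^bsub>M\<^esub> m' \<and> coded_enum M x1 y1 x2 y2 x3 y3 i = F j)"
    unfolding bijective_relation_def
  proof (intro conjI allI impI)
    fix i assume "i \<prec>\<^bsub>M\<^esub> m"
    then have "coded_enum M x1 y1 x2 y2 x3 y3 i \<in> F ` below M m'"
      using bij F by (auto simp: bij_betw_def below_def)
    then show "\<exists>j. j \<prec>\<^bsub>M\<^esub> m' \<and> j \<prec>\<^bsub>M\<^esub> m' \<and> coded_enum M x1 y1 x2 y2 x3 y3 i = F j"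
      by (auto simp: below_def)
  next
    fix j assume j: "j \<prec>\<^bsub>M\<^esub> m'"
    then have "F j \<in> coded_enum M x1 y1 x2 y2 x3 y3 ` below M m"
      using bij F by (auto simp: bij_betw_def below_def)
    with j show "\<exists>i. i \<prec>\<^bsub>M\<^esub> m \<and> j \<prec>\<^bsub>M\<^esub> m' \<and> coded_enum M x1 y1 x2 y2 x3 y3 i = F j"
      by (auto simp: below_def)
  next
    show "i = i'" if "i \<prec>\<^bsub>M\<^esub> m" "i' \<prec>\<^bsub>M\<^esub> m"
      "j \<prec>\<^bsub>M\<^esub> m' \<and> coded_enum M x1 y1 x2 y2 x3 y3 i = F j"
      "j \<prec>\<^bsub>M\<^esub> m' \<and> coded_enum M x1 y1 x2 y2 x3 y3 i' = F j" for i i' j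
      using that bij_betw_imp_inj_on[OF bij] by (auto simp: below_def inj_on_def)
    show "j = j'" if "j \<prec>\<^bsub>M\<^esub> m'" "j' \<prec>\<^bsub>M\<^esub> m'"
      "j \<prec>\<^bsub>M\<^esub> m' \<and> coded_enum M x1 y1 x2 y2 x3 y3 i = F j"
      "j' \<prec>\<^bsub>M\<^esub> m' \<and> coded_enum M x1 y1 x2 y2 x3 y3 i = F j'" for i j j'
      using that bij_betw_imp_inj_on[OF F] by (auto simp: below_def inj_on_def)
  qed
  ultimately show "m' = m" by blast
qed

end

section \<open>Counting pairwise incompatible sequences\<close>

text \<open>The list counterpart of \<open>seq_order\<close>, recursive so as to suit induction on
  lists.\<close>

fun before :: "'a list \<Rightarrow> ('a \<times> 'a) set" where
  "before [] = {}"
| "before (x # xs) = {x} \<times> set xs \<union> before xs"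

lemma before_subset_set: "before xs \<subseteq> set xs \<times> set xs"
  by (induction xs) auto

lemma before_filter: "before (filter P xs) = {(x, y) \<in> before xs. P x \<and> P y}"
  by (induction xs) auto

lemma before_conv_nth:
  "before xs = {(x, y). \<exists>i j. i < j \<and> j < length xs \<and> xs ! i = x \<and> xs ! j = y}"
proof (induction xs)
  case (Cons a xs)
  have "(x, y) \<in> before (a # xs) \<longleftrightarrow>
      (\<exists>i j. i < j \<and> j < length (a # xs) \<and> (a # xs) ! i = x \<and> (a # xs) ! j = y)" (is "_ \<longleftrightarrow> ?R") for x y
  proof
    assume "(x, y) \<in> before (a # xs)"
    then consider "x = a" "y \<in> set xs" | "(x, y) \<in> before xs" by auto
    then show ?R
    proof cases
      case 1
      then obtain j where "j < length xs" "xs ! j = y" by (auto simp: in_set_conv_nth)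
      with 1 show ?thesis by (intro exI[of _ 0] exI[of _ "Suc j"]) simp
    next
      case 2
      then obtain i j where "i < j" "j < length xs" "xs ! i = x" "xs ! j = y"
        using Cons.IH by auto
      then show ?thesis by (intro exI[of _ "Suc i"] exI[of _ "Suc j"]) simp
    qed
  next
    assume ?R
    then obtain i j where ij: "i < j" "j < length (a # xs)" "(a # xs) ! i = x" "(a # xs) ! j = y"
      by blast
    then obtain j' where j': "j = Suc j'" by (cases j) auto
    show "(x, y) \<in> before (a # xs)"
    proof (cases i)
      case 0
      with ij j' show ?thesis by auto
    next
      case (Suc i')
      with ij j' Cons.IH show ?thesis by auto
    qed
  qed
  then show ?case by auto
qed simp

text \<open>Two strict linear orders on one set cannot be properly nested. On lists, the heads must
  coincide: otherwise the head of \<open>ys\<close> comes after another entry and so occurs twice in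
  \<open>ys\<close>.\<close>

lemma before_subset_imp_eq:
  "distinct xs \<Longrightarrow> distinct ys \<Longrightarrow> set xs = set ys \<Longrightarrow> before xs \<subseteq> before ys \<Longrightarrow> xs = ys"
proof (induction xs arbitrary: ys)
  case (Cons a xs)
  from Cons.prems(3) obtain b zs where ys: "ys = b # zs" by (cases ys) auto
  have "a = b"
  proof (rule ccontr)
    assume "a \<noteq> b"
    then have "b \<in> set xs" using Cons.prems(3) ys by auto
    then have "(a, b) \<in> before ys" using subsetD[OF Cons.prems(4)] by simp
    then have "(a, b) \<in> before zs" using \<open>a \<noteq> b\<close> ys by simp
    then have "b \<in> set zs" using before_subset_set[of zs] by blast
    then show False using Cons.prems(2) ys by simp
  qed
  moreover have "before xs \<subseteq> before zs"
  proof (rule subrelI)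
    fix x y assume xy: "(x, y) \<in> before xs"
    then have "x \<in> set xs" using before_subset_set[of xs] by blast
    then have "x \<noteq> b" using Cons.prems(1) \<open>a = b\<close> by auto
    moreover have "(x, y) \<in> before ys" using subsetD[OF Cons.prems(4)] xy by simp
    ultimately show "(x, y) \<in> before zs" using ys by simp
  qed
  moreover have "set xs = set zs"
    using Cons.prems(1-3) \<open>a = b\<close> ys by (simp add: insert_ident)
  ultimately show ?case using Cons.IH[of zs] Cons.prems(1,2) ys by simp
qed simp

text \<open>Turns extending \<open>r\<close> into a prescribed value of the restriction map, so that
  linear extensions become fibres that can be counted. The inclusion of sets matters when
  \<open>r\<close> is a singleton, since \<open>before r\<close> is then empty.\<close>

lemma before_subset_iff_filter:
  assumes "distinct xs" "distinct r" "set r \<subseteq> set xs"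
  shows "before r \<subseteq> before xs \<longleftrightarrow> filter (\<lambda>x. x \<in> set r) xs = r"
proof
  assume "before r \<subseteq> before xs"
  then have "before r \<subseteq> before (filter (\<lambda>x. x \<in> set r) xs)"
    using before_subset_set[of r] by (auto simp: before_filter)
  then have "r = filter (\<lambda>x. x \<in> set r) xs"
    using assms by (intro before_subset_imp_eq) auto
  then show "filter (\<lambda>x. x \<in> set r) xs = r" by (rule sym)
next
  assume "filter (\<lambda>x. x \<in> set r) xs = r"
  moreover have "before (filter (\<lambda>x. x \<in> set r) xs) \<subseteq> before xs" by (auto simp: before_filter)
  ultimately show "before r \<subseteq> before xs" by simp
qed

text \<open>Relabelling by the bijection \<open>\<sigma>\<close> that sends \<open>r\<close> to
  \<open>r'\<close> entry by entry and fixes everything outside \<open>S\<close> maps one fibre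
  injectively into the other. Exchanging \<open>r\<close> and \<open>r'\<close> gives
  equality.\<close>

lemma card_permutations_filter_le:
  assumes "finite U" "S \<subseteq> U" "r \<in> permutations_of_set S" "r' \<in> permutations_of_set S"
  shows "card {xs \<in> permutations_of_set U. filter (\<lambda>x. x \<in> S) xs = r} \<le>
    card {xs \<in> permutations_of_set U. filter (\<lambda>x. x \<in> S) xs = r'}"
proof -
  define \<sigma> where "\<sigma> x = (if x \<in> S then the (map_of (zip r r') x) else x)" for x
  have r: "set r = S" "distinct r" "set r' = S" "distinct r'"
    using assms permutations_of_setD by auto
  have len: "length r = length r'"
    using distinct_card[OF r(2)] distinct_card[OF r(4)] r(1,3) by simp
  have map_r: "map \<sigma> r = r'"
  proof (rule nth_equalityI)
    fix i assume "i < length (map \<sigma> r)"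
    then have i: "i < length r" by simp
    with nth_mem[OF i] show "map \<sigma> r ! i = r' ! i"
      using len r(2) by (simp add: \<sigma>_def r(1) map_of_zip_nth)
  qed (simp add: len)
  have "distinct (map \<sigma> r)" unfolding map_r by (rule r(4))
  then have inj_S: "inj_on \<sigma> S" unfolding distinct_map r(1) by simp
  have image_S: "\<sigma> ` S = S" using arg_cong[OF map_r, of set] r(1,3) by simp
  have id: "\<sigma> x = x" if "x \<notin> S" for x using that by (simp add: \<sigma>_def)
  have S_iff: "\<sigma> x \<in> S \<longleftrightarrow> x \<in> S" for x
  proof (cases "x \<in> S")
    case True
    then have "\<sigma> x \<in> \<sigma> ` S" by (rule imageI)
    with True show ?thesis by (simp only: image_S)
  qed (simp add: id)
  have inj: "inj_on \<sigma> U"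
  proof (rule inj_onI)
    fix x y assume eq: "\<sigma> x = \<sigma> y"
    then have "x \<in> S \<longleftrightarrow> y \<in> S" using S_iff[of x] S_iff[of y] by simp
    then consider "x \<in> S" "y \<in> S" | "x \<notin> S" "y \<notin> S" by blast
    then show "x = y"
    proof cases
      case 1
      then show ?thesis by (rule inj_onD[OF inj_S eq])
    next
      case 2
      then show ?thesis using eq by (simp add: id)
    qed
  qed
  have "\<sigma> ` U = \<sigma> ` S \<union> \<sigma> ` (U - S)" using assms(2) by blast
  also have "\<dots> = U" using image_S id assms(2) by auto
  finally have image: "\<sigma> ` U = U" .
  show ?thesis
  proof (rule card_inj_on_le)
    show "inj_on (map \<sigma>) {xs \<in> permutations_of_set U. filter (\<lambda>x. x \<in> S) xs = r}"
    proof (rule inj_onI)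
      fix xs ys
      assume "xs \<in> {xs \<in> permutations_of_set U. filter (\<lambda>x. x \<in> S) xs = r}"
        "ys \<in> {xs \<in> permutations_of_set U. filter (\<lambda>x. x \<in> S) xs = r}" and eq: "map \<sigma> xs = map \<sigma> ys"
      then have "set xs = U" "set ys = U" by (auto dest: permutations_of_setD)
      with inj have "inj_on \<sigma> (set xs \<union> set ys)" by simp
      with eq show "xs = ys" by (simp add: inj_on_map_eq_map)
    qed
    show "map \<sigma> ` {xs \<in> permutations_of_set U. filter (\<lambda>x. x \<in> S) xs = r} \<subseteq>
        {xs \<in> permutations_of_set U. filter (\<lambda>x. x \<in> S) xs = r'}"
    proof clarify
      fix xs assume xs: "xs \<in> permutations_of_set U" "r = filter (\<lambda>x. x \<in> S) xs"
      then have U: "set xs = U" "distinct xs" by (auto dest: permutations_of_setD)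
      then have "map \<sigma> xs \<in> permutations_of_set U"
        using inj image by (intro permutations_of_setI) (auto simp: distinct_map)
      moreover have "filter (\<lambda>x. x \<in> S) (map \<sigma> xs) = r'"
        using map_r xs(2) by (simp add: filter_map o_def S_iff)
      ultimately show "map \<sigma> xs \<in> permutations_of_set U \<and> filter (\<lambda>x. x \<in> S) (map \<sigma> xs) = r'" ..
    qed
    show "finite {xs \<in> permutations_of_set U. filter (\<lambda>x. x \<in> S) xs = r'}" by simp
  qed
qed

text \<open>Restriction to the entries of \<open>r\<close> splits all permutations of
  \<open>U\<close> into fibres, one for each of the \<open>fact (length r)\<close> arrangements, and
  all fibres have the same size.\<close>

lemma card_linear_extensions:
  assumes "finite U" "distinct r" "set r \<subseteq> U"
  shows "card {xs \<in> permutations_of_set U. before r \<subseteq> before xs} * fact (length r) = fact (card U)"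
proof -
  let ?S = "set r"
  let ?E = "\<lambda>r'. {xs \<in> permutations_of_set U. filter (\<lambda>x. x \<in> ?S) xs = r'}"
  have r: "r \<in> permutations_of_set ?S" using assms by auto
  have filter_perm: "filter (\<lambda>x. x \<in> ?S) xs \<in> permutations_of_set ?S" if "xs \<in> permutations_of_set U" for xs
    using permutations_of_setD[OF that] assms(3) by (intro permutations_of_setI) auto
  have "fact (card U) = card (permutations_of_set U)" using assms by simp
  also have "permutations_of_set U = (\<Union>r'\<in>permutations_of_set ?S. ?E r')"
    using filter_perm by blast
  also have "card \<dots> = (\<Sum>r'\<in>permutations_of_set ?S. card (?E r'))"
    by (rule card_UN_disjoint) auto
  also have "\<dots> = (\<Sum>r'\<in>permutations_of_set ?S. card (?E r))"
    using card_permutations_filter_le[OF assms(1,3)] r by (intro sum.cong refl antisym) auto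
  also have "\<dots> = card (?E r) * fact (length r)"
    using assms(2) by (simp add: distinct_card)
  also have "?E r = {xs \<in> permutations_of_set U. before r \<subseteq> before xs}"
  proof (intro Collect_cong conj_cong refl)
    fix xs assume "xs \<in> permutations_of_set U"
    then have "distinct xs" "set r \<subseteq> set xs" using assms(3) by (simp_all add: permutations_of_set_def)
    then show "filter (\<lambda>x. x \<in> ?S) xs = r \<longleftrightarrow> before r \<subseteq> before xs"
      using assms(2) by (simp add: before_subset_iff_filter)
  qed
  finally show ?thesis by (rule sym)
qed

text \<open>
  Pairwise incompatible sequences have disjoint sets of linear extensions, and a sequence of
  length \<open>k\<close> on a set of size \<open>N\<close> has \<open>N!/k!\<close> of them.
\<close>

lemma card_incompatible_le:
  fixes r :: "'i \<Rightarrow> 'a list"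
  assumes U: "finite U" and I: "finite I"
    and s: "distinct s" "set s \<subseteq> U"
    and r: "\<And>i. i \<in> I \<Longrightarrow> distinct (r i) \<and> set (r i) \<subseteq> U \<and> length (r i) \<le> L \<and> before s \<subseteq> before (r i)"
    and incompatible: "\<And>i j t. i \<in> I \<Longrightarrow> j \<in> I \<Longrightarrow> i \<noteq> j \<Longrightarrow> distinct t \<Longrightarrow> set t \<subseteq> U \<Longrightarrow>
      length t \<le> length (r i) + length (r j) \<Longrightarrow> before (r i) \<subseteq> before t \<Longrightarrow> \<not> before (r j) \<subseteq> before t"
  shows "card I * fact (length s) \<le> (fact L :: nat)"
proof -
  define E where "E r = {xs \<in> permutations_of_set U. before r \<subseteq> before xs}" for r
  have E: "card (E q) * fact (length q) = fact (card U)" if "distinct q" "set q \<subseteq> U" for q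
    using card_linear_extensions[OF U that] by (simp add: E_def)
  have disjoint: "E (r i) \<inter> E (r j) = {}" if ij: "i \<in> I" "j \<in> I" "i \<noteq> j" for i j
  proof (rule equals0I)
    fix xs assume "xs \<in> E (r i) \<inter> E (r j)"
    then have xs: "set xs = U" "distinct xs" "before (r i) \<subseteq> before xs" "before (r j) \<subseteq> before xs"
      by (auto simp: E_def dest: permutations_of_setD)
    let ?V = "set (r i) \<union> set (r j)"
    \<comment> \<open>A common linear extension is cut down to the entries of the two sequences,
      because incompatibility is assumed only for \<open>t\<close> within this length.\<close>
    define t where "t = filter (\<lambda>x. x \<in> ?V) xs"
    have t: "distinct t" "set t \<subseteq> U" "set t \<subseteq> ?V" using xs by (auto simp: t_def)
    have "length t \<le> card ?V" using t card_mono[of ?V "set t"] by (simp add: distinct_card)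
    also have "\<dots> \<le> length (r i) + length (r j)"
      using card_Un_le[of "set (r i)" "set (r j)"] card_length[of "r i"] card_length[of "r j"] by linarith
    finally have "length t \<le> length (r i) + length (r j)" .
    moreover have "before (r i) \<subseteq> before t" "before (r j) \<subseteq> before t"
      using xs(3,4) before_subset_set[of "r i"] before_subset_set[of "r j"]
      by (auto simp: t_def before_filter)
    ultimately show False using incompatible[OF ij] t by blast
  qed
  have fin: "finite (E q)" for q by (simp add: E_def)
  \<comment> \<open>Every summand equals \<open>fact (card U)\<close>. Raising each factorial to
    \<open>fact L\<close> leaves a sum over disjoint sets, all contained in \<open>E s\<close>
    because every \<open>r i\<close> extends \<open>s\<close>.\<close>
  have "card I * fact (card U) = (\<Sum>i\<in>I. card (E (r i)) * fact (length (r i)))"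
    using E r by simp
  also have "\<dots> \<le> (\<Sum>i\<in>I. card (E (r i)) * fact L)"
    using r by (intro sum_mono mult_left_mono fact_mono) auto
  also have "\<dots> = card (\<Union>i\<in>I. E (r i)) * fact L"
    using card_UN_disjoint[OF I, of "\<lambda>i. E (r i)"] fin disjoint by (simp add: sum_distrib_right)
  also have "\<dots> \<le> card (E s) * fact L"
    using r by (intro mult_right_mono card_mono fin) (auto simp: E_def)
  finally have "card I * fact (card U) * fact (length s) \<le> card (E s) * fact L * fact (length s)"
    by (rule mult_right_mono) simp
  also have "\<dots> = fact L * fact (card U)" using E[OF s] by (simp add: mult_ac)
  finally have "fact (card U) * (card I * fact (length s)) \<le> fact (card U) * (fact L :: nat)"
    by (simp add: mult_ac)
  then show ?thesis by simp
qed

section \<open>Goedel's beta function in the standard model\<close>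

text \<open>Goedel's choice of moduli: with \<open>y = fact K\<close>,
  \<open>D j - D i = (j - i) * y\<close>, where \<open>j - i\<close> divides \<open>y\<close> and
  \<open>D i\<close> is coprime to \<open>y\<close>. The moduli are thus pairwise coprime, and they
  exceed all values since \<open>f i \<le> K \<le> fact K\<close>; the Chinese remainder theorem
  supplies \<open>x\<close>.\<close>

lemma beta_code: "\<exists>x y. \<forall>i<k. beta nat_arith x y i = f i"
proof -
  define K where "K = Max (insert k (f ` {..<k}))"
  define y :: nat where "y = fact K"
  define D where "D i = 1 + (i + 1) * y" for i
  have K: "k \<le> K" "\<And>i. i < k \<Longrightarrow> f i \<le> K"
    unfolding K_def by (auto intro: Max_ge)
  have "coprime (D i) (D j)" if ij: "i < j" "j < k" for i j
  proof -
    obtain c where c: "j = i + c" using ij(1) less_imp_add_positive by blast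
    have "gcd y (D i) = gcd y 1" unfolding D_def add.commute[of 1] by (rule gcd_add_mult)
    then have y: "coprime (D i) y" by (simp add: coprime_iff_gcd_eq_1 gcd.commute)
    have "c dvd y" unfolding y_def using ij K(1) c by (intro dvd_fact) auto
    from coprime_divisors[OF dvd_refl this y] y have "coprime (D i) (c * y)" by simp
    moreover have "D j = D i + c * y" by (simp add: D_def c algebra_simps)
    ultimately show ?thesis by (simp add: coprime_iff_gcd_eq_1)
  qed
  then have "coprime (D i) (D j)" if "i < k" "j < k" "i \<noteq> j" for i j
    using that coprime_commute by (cases i j rule: linorder_cases) blast+
  then have cop: "\<forall>i\<in>{..<k}. \<forall>j\<in>{..<k}. i \<noteq> j \<longrightarrow> coprime (D i) (D j)" by simp
  obtain x where x: "\<forall>i\<in>{..<k}. [x = f i] (mod (D i))"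
    using chinese_remainder_nat[OF _ cop] by blast
  have "beta nat_arith x y i = f i" if "i < k" for i
  proof -
    have "f i \<le> y" using K(2)[OF that] fact_ge_self[of K] unfolding y_def by (rule order_trans)
    then have "f i < D i" by (simp add: D_def)
    then show ?thesis using x that by (simp add: beta_nat cong_def D_def)
  qed
  then show ?thesis by blast
qed

section \<open>The array bound as a first-order statement\<close>

text \<open>Membership in \<open>Oseqs\<close> at the level of codes, without its length
  bound.\<close>

definition valid_code :: "'m arith \<Rightarrow> 'm \<Rightarrow> 'm \<Rightarrow> 'm \<Rightarrow> 'm \<Rightarrow> bool"
  where "valid_code M n l x y \<longleftrightarrow>
    (\<forall>i j. i \<prec>\<^bsub>M\<^esub> l \<longrightarrow> j \<prec>\<^bsub>M\<^esub> l \<longrightarrow> beta M x y i = beta M x y j \<longrightarrow> i = j) \<and>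
    (\<forall>i. i \<prec>\<^bsub>M\<^esub> l \<longrightarrow> beta M x y i \<prec>\<^bsub>M\<^esub> n)"

definition code_extends :: "'m arith \<Rightarrow> 'm \<Rightarrow> 'm \<Rightarrow> 'm \<Rightarrow> 'm \<Rightarrow> 'm \<Rightarrow> 'm \<Rightarrow> bool"
  where "code_extends M l' x' y' l x y \<longleftrightarrow>
    (\<forall>i j. i \<prec>\<^bsub>M\<^esub> j \<longrightarrow> i \<prec>\<^bsub>M\<^esub> l \<longrightarrow> j \<prec>\<^bsub>M\<^esub> l \<longrightarrow>
      (\<exists>i' j'. i' \<prec>\<^bsub>M\<^esub> j' \<and> i' \<prec>\<^bsub>M\<^esub> l' \<and> j' \<prec>\<^bsub>M\<^esub> l' \<and>
        beta M x' y' i' = beta M x y i \<and> beta M x' y' j' = beta M x y j))"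

lemma valid_code_iff:
  "valid_code M n l x y \<longleftrightarrow>
    inj_on (decode M l x y) (dom (decode M l x y)) \<and> ran (decode M l x y) \<subseteq> below M n"
  unfolding valid_code_def inj_on_def ran_def below_def dom_def decode_def
  by (auto split: if_splits)

lemma code_extends_iff:
  "code_extends M l' x' y' l x y \<longleftrightarrow> extends M (decode M l' x' y') (decode M l x y)"
proof -
  have order: "(u, v) \<in> seq_order M (decode M l x y) \<longleftrightarrow>
      (\<exists>i j. i \<prec>\<^bsub>M\<^esub> j \<and> i \<prec>\<^bsub>M\<^esub> l \<and> j \<prec>\<^bsub>M\<^esub> l \<and> beta M x y i = u \<and> beta M x y j = v)"
    for u v l x y
    unfolding seq_order_def decode_def by (auto split: if_splits)
  show ?thesis unfolding code_extends_def extends_def subset_iff split_paired_All order by blast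
qed

text \<open>
  \<open>R a b l x y\<close> stands for \<open>decode M l x y \<in> A a b\<close>. The length of a common extension is bounded
  by the sum of the two lengths, because the length bound of \<^const>\<open>Oseqs\<close>, a power with
  standard exponent, is not first-order.
\<close>

definition array_conditions ::
    "'m arith \<Rightarrow> 'm \<Rightarrow> 'm \<Rightarrow> 'm \<Rightarrow> 'm \<Rightarrow> 'm \<Rightarrow> 'm \<Rightarrow> 'm \<Rightarrow>
      ('m \<Rightarrow> 'm \<Rightarrow> 'm \<Rightarrow> 'm \<Rightarrow> 'm \<Rightarrow> bool) \<Rightarrow> bool"
  where "array_conditions M n p h d l x y R \<longleftrightarrow>
    valid_code M n l x y \<and>
    (\<forall>a b l1 x1 y1. a \<prec>\<^bsub>M\<^esub> p \<longrightarrow> b \<prec>\<^bsub>M\<^esub> h \<longrightarrow> R a b l1 x1 y1 \<longrightarrow>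
      valid_code M n l1 x1 y1 \<and> l1 \<preceq>\<^bsub>M\<^esub> l \<oplus>\<^bsub>M\<^esub> d \<and> code_extends M l1 x1 y1 l x y) \<and>
    (\<forall>a a' b l1 x1 y1 l2 x2 y2. a \<prec>\<^bsub>M\<^esub> p \<longrightarrow> a' \<prec>\<^bsub>M\<^esub> p \<longrightarrow> b \<prec>\<^bsub>M\<^esub> h \<longrightarrow>
      R a b l1 x1 y1 \<longrightarrow> R a' b l2 x2 y2 \<longrightarrow>
      a \<noteq> a' \<or> decode M l1 x1 y1 \<noteq> decode M l2 x2 y2 \<longrightarrow>
      \<not> (\<exists>l3 x3 y3. l3 \<preceq>\<^bsub>M\<^esub> l1 \<oplus>\<^bsub>M\<^esub> l2 \<and> valid_code M n l3 x3 y3 \<and>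
        code_extends M l3 x3 y3 l1 x1 y1 \<and> code_extends M l3 x3 y3 l2 x2 y2))"

text \<open>First-order substitute for \<open>mcard\<close>. Distinctness and exhaustion concern
  decoded sequences, not codes, so that this is meaningful even if \<open>P\<close> distinguishes
  codes of the same sequence.\<close>

definition coded_card :: "'m arith \<Rightarrow> ('m \<Rightarrow> 'm \<Rightarrow> 'm \<Rightarrow> bool) \<Rightarrow> 'm \<Rightarrow> bool"
  where "coded_card M P m \<longleftrightarrow> (\<exists>x1 y1 x2 y2 x3 y3.
    (\<forall>i. i \<prec>\<^bsub>M\<^esub> m \<longrightarrow> P (beta M x1 y1 i) (beta M x2 y2 i) (beta M x3 y3 i)) \<and>
    (\<forall>i j. i \<prec>\<^bsub>M\<^esub> m \<longrightarrow> j \<prec>\<^bsub>M\<^esub> m \<longrightarrow>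
      coded_enum M x1 y1 x2 y2 x3 y3 i = coded_enum M x1 y1 x2 y2 x3 y3 j \<longrightarrow> i = j) \<and>
    (\<forall>l x y. P l x y \<longrightarrow>
      (\<exists>i. i \<prec>\<^bsub>M\<^esub> m \<and> decode M l x y = coded_enum M x1 y1 x2 y2 x3 y3 i)))"

text \<open>The code lists the partial sums. Summands enter as a relation because a cardinality is
  itself available only through \<open>coded_card\<close>; nested sums then need no new
  notion.\<close>

definition coded_sum :: "'m arith \<Rightarrow> ('m \<Rightarrow> 'm \<Rightarrow> bool) \<Rightarrow> 'm \<Rightarrow> 'm \<Rightarrow> bool"
  where "coded_sum M T k v \<longleftrightarrow> (\<exists>x y. beta M x y \<zero>\<^bsub>M\<^esub> = \<zero>\<^bsub>M\<^esub> \<and>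
    (\<forall>i. i \<prec>\<^bsub>M\<^esub> k \<longrightarrow> (\<exists>m. T i m \<and> beta M x y (i \<oplus>\<^bsub>M\<^esub> \<one>\<^bsub>M\<^esub>) = beta M x y i \<oplus>\<^bsub>M\<^esub> m)) \<and>
    beta M x y k = v)"

text \<open>One factorial table up to \<open>l \<oplus> d\<close> supplies both factorials. The
  quotient is stated as an exact factor \<open>q\<close> of a positive divisor, which determines the
  value of \<open>mdiv\<close>.\<close>

definition size_bound ::
    "'m arith \<Rightarrow> 'm \<Rightarrow> 'm \<Rightarrow> 'm \<Rightarrow> 'm \<Rightarrow> ('m \<Rightarrow> 'm \<Rightarrow> 'm \<Rightarrow> 'm \<Rightarrow> 'm \<Rightarrow> bool) \<Rightarrow> bool"
  where "size_bound M p h d l R \<longleftrightarrow> (\<exists>u v q t.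
    beta M u v \<zero>\<^bsub>M\<^esub> = \<one>\<^bsub>M\<^esub> \<and>
    (\<forall>i. i \<prec>\<^bsub>M\<^esub> l \<oplus>\<^bsub>M\<^esub> d \<longrightarrow>
      beta M u v (i \<oplus>\<^bsub>M\<^esub> \<one>\<^bsub>M\<^esub>) = (i \<oplus>\<^bsub>M\<^esub> \<one>\<^bsub>M\<^esub>) \<otimes>\<^bsub>M\<^esub> beta M u v i) \<and>
    \<zero>\<^bsub>M\<^esub> \<prec>\<^bsub>M\<^esub> beta M u v l \<and>
    beta M u v (l \<oplus>\<^bsub>M\<^esub> d) = q \<otimes>\<^bsub>M\<^esub> beta M u v l \<and>
    coded_sum M (\<lambda>a w. coded_sum M (\<lambda>b m. coded_card M (R a b) m) h w) p t \<and>
    t \<preceq>\<^bsub>M\<^esub> h \<otimes>\<^bsub>M\<^esub> q)"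

section \<open>The bound in the standard model, with codes read as lists\<close>

definition decode_list :: "nat \<Rightarrow> nat \<Rightarrow> nat \<Rightarrow> nat list"
  where "decode_list l x y = map (beta nat_arith x y) [0..<l]"

lemma length_decode_list [simp]: "length (decode_list l x y) = l"
  by (simp add: decode_list_def)

lemma decode_list_exists: "\<exists>x y. decode_list (length t) x y = t"
proof -
  obtain x y where xy: "\<forall>i<length t. beta nat_arith x y i = t ! i"
    using beta_code[of "length t" "(!) t"] by blast
  have "decode_list (length t) x y = t"
    by (rule nth_equalityI) (simp_all add: decode_list_def xy)
  then show ?thesis by blast
qed

lemma decode_nat_eq_iff:
  "decode nat_arith l x y = decode nat_arith l' x' y' \<longleftrightarrow> decode_list l x y = decode_list l' x' y'"
proof -
  have "(\<forall>i. i < l \<longleftrightarrow> i < l') \<longleftrightarrow> l = l'"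
    using less_irrefl linorder_neqE_nat[of l l'] by blast
  moreover have "decode_list l x y = decode_list l' x' y' \<longleftrightarrow>
      l = l' \<and> (\<forall>i<l. beta nat_arith x y i = beta nat_arith x' y' i)"
    unfolding decode_list_def list_eq_iff_nth_eq by (simp cong: conj_cong)
  ultimately show ?thesis
    unfolding decode_eq_iff nat_arith_simps all_conj_distrib by blast
qed

lemma valid_code_nat:
  "valid_code nat_arith n l x y \<longleftrightarrow> distinct (decode_list l x y) \<and> set (decode_list l x y) \<subseteq> {..<n}"
  by (auto simp: valid_code_def decode_list_def distinct_map inj_on_def image_subset_iff)

lemma code_extends_nat:
  "code_extends nat_arith l' x' y' l x y \<longleftrightarrow> before (decode_list l x y) \<subseteq> before (decode_list l' x' y')"
proof -
  have order: "(u, v) \<in> before (decode_list l x y) \<longleftrightarrow>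
      (\<exists>i j. i < j \<and> i < l \<and> j < l \<and> beta nat_arith x y i = u \<and> beta nat_arith x y j = v)"
    for u v l x y
    unfolding before_conv_nth mem_Collect_eq prod.case by (intro ex_cong1) (auto simp: decode_list_def)
  show ?thesis
    unfolding code_extends_def nat_arith_simps subset_iff split_paired_All order by blast
qed

lemma coded_sum_nat:
  assumes "\<And>i. i < k \<Longrightarrow> T i (m i)"
  shows "coded_sum nat_arith T k (\<Sum>i<k. m i)"
proof -
  \<comment> \<open>There are \<open>k + 1\<close> partial sums, from the empty one to the one over
    all \<open>i < k\<close>.\<close>
  obtain x y where xy: "\<forall>i<Suc k. beta nat_arith x y i = (\<Sum>j<i. m j)"
    using beta_code[of "Suc k" "\<lambda>i. \<Sum>j<i. m j"] by blast
  show ?thesis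
    unfolding coded_sum_def nat_arith_simps
  proof (rule exI[of _ x], rule exI[of _ y], intro conjI allI impI)
    show "\<exists>m. T i m \<and> beta nat_arith x y (i + 1) = beta nat_arith x y i + m" if "i < k" for i
      using xy[rule_format, of i] xy[rule_format, of "i + 1"] assms[OF that] that
      by (intro exI[of _ "m i"]) simp
  qed (use xy[rule_format, of 0] xy[rule_format, of k] in simp_all)
qed

text \<open>One code triple is chosen for each element of a finite enumeration, and the three
  component functions are beta-coded separately.\<close>

lemma coded_card_nat:
  assumes "finite {decode_list l x y |l x y. P l x y}"
  shows "coded_card nat_arith P (card {decode_list l x y |l x y. P l x y})"
proof -
  let ?S = "{decode_list l x y |l x y. P l x y}"
  obtain f where f: "bij_betw f {0..<card ?S} ?S" using ex_bij_betw_nat_finite[OF assms] by blast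
  have "\<exists>l x y. P l x y \<and> decode_list l x y = f i" if "i < card ?S" for i
  proof -
    have "f i \<in> ?S" using that by (intro bij_betw_apply[OF f]) simp
    then obtain l x y where "f i = decode_list l x y" "P l x y" by blast
    then show ?thesis by (intro exI[of _ l] exI[of _ x] exI[of _ y]) simp
  qed
  then have "\<forall>i. \<exists>l x y. i < card ?S \<longrightarrow> P l x y \<and> decode_list l x y = f i" by blast
  then obtain l x y where lxy:
    "\<And>i. i < card ?S \<Longrightarrow> P (l i) (x i) (y i) \<and> decode_list (l i) (x i) (y i) = f i"
    unfolding choice_iff by blast
  obtain x1 y1 where 1: "\<forall>i<card ?S. beta nat_arith x1 y1 i = l i"
    using beta_code[of "card ?S" l] by blast
  obtain x2 y2 where 2: "\<forall>i<card ?S. beta nat_arith x2 y2 i = x i"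
    using beta_code[of "card ?S" x] by blast
  obtain x3 y3 where 3: "\<forall>i<card ?S. beta nat_arith x3 y3 i = y i"
    using beta_code[of "card ?S" y] by blast
  note codes = 1[rule_format] 2[rule_format] 3[rule_format]
  show ?thesis
    unfolding coded_card_def nat_arith_simps coded_enum_def
  proof (rule exI[of _ x1], rule exI[of _ y1], rule exI[of _ x2], rule exI[of _ y2],
      rule exI[of _ x3], rule exI[of _ y3], intro conjI allI impI)
    fix i assume "i < card ?S"
    then show "P (beta nat_arith x1 y1 i) (beta nat_arith x2 y2 i) (beta nat_arith x3 y3 i)"
      using lxy by (simp add: codes)
  next
    fix i j
    assume i: "i < card ?S" and j: "j < card ?S"
      and "decode nat_arith (beta nat_arith x1 y1 i) (beta nat_arith x2 y2 i) (beta nat_arith x3 y3 i) =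
        decode nat_arith (beta nat_arith x1 y1 j) (beta nat_arith x2 y2 j) (beta nat_arith x3 y3 j)"
    then have "f i = f j" using lxy by (simp add: codes decode_nat_eq_iff)
    then show "i = j" using inj_onD[OF bij_betw_imp_inj_on[OF f]] i j by simp
  next
    fix l' x' y' assume "P l' x' y'"
    then have "decode_list l' x' y' \<in> f ` {0..<card ?S}" using bij_betw_imp_surj_on[OF f] by blast
    then obtain i where i: "i < card ?S" "decode_list l' x' y' = f i" by auto
    then show "\<exists>i<card ?S. decode nat_arith l' x' y' =
        decode nat_arith (beta nat_arith x1 y1 i) (beta nat_arith x2 y2 i) (beta nat_arith x3 y3 i)"
      using lxy by (intro exI[of _ i]) (simp add: codes decode_nat_eq_iff)
  qed
qed

lemma array_bound_nat:
  assumes "array_conditions nat_arith n p h d l x y R"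
  shows "size_bound nat_arith p h d l R"
proof -
  define S where "S a b = {decode_list l x y |l x y. R a b l x y}" for a b
  define s where "s = decode_list l x y"
  note C = assms[unfolded array_conditions_def nat_arith_simps valid_code_nat code_extends_nat
      decode_nat_eq_iff, folded s_def]
  have s: "distinct s" "set s \<subseteq> {..<n}" "length s = l"
    using conjunct1[OF C] by (simp_all add: s_def)
  have S: "distinct r \<and> set r \<subseteq> {..<n} \<and> length r \<le> l + d \<and> before s \<subseteq> before r"
    if "a < p" "b < h" "r \<in> S a b" for a b r
  proof -
    from that(3) obtain l1 x1 y1 where "R a b l1 x1 y1" "r = decode_list l1 x1 y1"
      unfolding S_def by blast
    then show ?thesis using C that(1,2) by simp
  qed
  have incompatible: "\<not> before r2 \<subseteq> before t"
    if "a < p" "a' < p" "b < h" "r1 \<in> S a b" "r2 \<in> S a' b" "a \<noteq> a' \<or> r1 \<noteq> r2"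
      "distinct t" "set t \<subseteq> {..<n}" "length t \<le> length r1 + length r2" "before r1 \<subseteq> before t"
    for a a' b r1 r2 t
  proof
    assume ext: "before r2 \<subseteq> before t"
    from that(4,5) obtain l1 x1 y1 l2 x2 y2 where R: "R a b l1 x1 y1" "R a' b l2 x2 y2"
      and r: "r1 = decode_list l1 x1 y1" "r2 = decode_list l2 x2 y2"
      unfolding S_def by blast
    obtain x3 y3 where t: "decode_list (length t) x3 y3 = t" using decode_list_exists by blast
    have "\<not> (\<exists>l3 x3 y3. l3 \<le> l1 + l2 \<and>
        (distinct (decode_list l3 x3 y3) \<and> set (decode_list l3 x3 y3) \<subseteq> {..<n}) \<and>
        before r1 \<subseteq> before (decode_list l3 x3 y3) \<and> before r2 \<subseteq> before (decode_list l3 x3 y3))"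
      using conjunct2[OF conjunct2[OF C]] that(1-3,6) R unfolding r by blast
    moreover have "length t \<le> l1 + l2" using that(9) by (simp add: r)
    ultimately show False using that(7,8,10) ext t by metis
  qed
  have finite: "finite (S a b)" if "a < p" "b < h" for a b
  proof (rule finite_subset)
    show "S a b \<subseteq> {r. set r \<subseteq> {..<n} \<and> length r \<le> l + d}" using S that by blast
  qed (simp add: finite_lists_length_le)
  define q :: nat where "q = fact (l + d) div fact l"
  have q: "fact (l + d) = q * fact l"
    unfolding q_def by (simp add: fact_dvd)
  have column: "(\<Sum>a<p. card (S a b)) \<le> q" if b: "b < h" for b
  proof -
    \<comment> \<open>The disjoint union counts a sequence once for each cell of the column, as the
      sum does. Two distinct pairs differ in \<open>a\<close> or in the sequence, exactly the case
      in which incompatibility is known.\<close>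
    let ?I = "SIGMA a:{..<p}. S a b"
    have "card ?I * fact (length s) \<le> (fact (l + d) :: nat)"
    proof (rule card_incompatible_le[where U = "{..<n}" and r = snd])
      show "finite ?I" using finite b by auto
      show "distinct (snd i) \<and> set (snd i) \<subseteq> {..<n} \<and> length (snd i) \<le> l + d \<and> before s \<subseteq> before (snd i)"
        if "i \<in> ?I" for i
      proof -
        from that have "fst i < p" "snd i \<in> S (fst i) b" by auto
        then show ?thesis using S b by blast
      qed
      show "\<not> before (snd j) \<subseteq> before t"
        if "i \<in> ?I" "j \<in> ?I" "i \<noteq> j" "distinct t" "set t \<subseteq> {..<n}"
          "length t \<le> length (snd i) + length (snd j)" "before (snd i) \<subseteq> before t" for i j t
        using incompatible[of "fst i" "fst j" b "snd i" "snd j" t] that b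
        by (auto simp: prod_eq_iff)
    qed (use s in auto)
    then have "card ?I * fact l \<le> q * fact l" by (simp only: q s(3))
    then have "card ?I \<le> q" by simp
    then show ?thesis using finite b by (simp add: card_SigmaI)
  qed
  obtain u v where uv: "\<forall>i<Suc (l + d). beta nat_arith u v i = fact i"
    using beta_code[of "Suc (l + d)" fact] by blast
  \<comment> \<open>The bound \<open>q\<close> holds for each column \<open>b\<close>, whereas the
    size sums over \<open>a\<close> outermost.\<close>
  have "(\<Sum>a<p. \<Sum>b<h. card (S a b)) = (\<Sum>b<h. \<Sum>a<p. card (S a b))" by (rule sum.swap)
  also have "\<dots> \<le> (\<Sum>b<h. q)" by (intro sum_mono column) simp
  finally have total: "(\<Sum>a<p. \<Sum>b<h. card (S a b)) \<le> h * q" by simp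
  have "coded_card nat_arith (R a b) (card (S a b))" if "a < p" "b < h" for a b
    using coded_card_nat[of "R a b"] finite[OF that] by (simp add: S_def)
  then have "coded_sum nat_arith (\<lambda>a w. coded_sum nat_arith (\<lambda>b m. coded_card nat_arith (R a b) m) h w) p
      (\<Sum>a<p. \<Sum>b<h. card (S a b))"
    by (intro coded_sum_nat)
  with total uv q show ?thesis
    unfolding size_bound_def nat_arith_simps
    by (intro exI[of _ u] exI[of _ v] exI[of _ q] exI[of _ "\<Sum>a<p. \<Sum>b<h. card (S a b)"]) simp
qed

section \<open>The coded bound inside \<open>M\<close>\<close>

context arithmetic_model
begin

text \<open>For each \<open>\<phi>\<close> one formula is transferred, whose free variables are the
  parameters of \<open>\<phi>\<close>; the fixed assignment \<open>e\<close> enters only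
  afterwards.\<close>

lemma array_bound:
  assumes "array_conditions M n p h d l x y (\<lambda>a b l x y. sat M (prepend [a, b, l, x, y] e) \<phi>)"
  shows "size_bound M p h d l (\<lambda>a b l x y. sat M (prepend [a, b, l, x, y] e) \<phi>)"
proof -
  have "codef M
    (\<lambda>e. \<forall>n p h d l x y. array_conditions nat_arith n p h d l x y
        (\<lambda>a b l x y. sat nat_arith (prepend [a, b, l, x, y] (\<lambda>i. e i)) \<phi>) \<longrightarrow>
      size_bound nat_arith p h d l (\<lambda>a b l x y. sat nat_arith (prepend [a, b, l, x, y] (\<lambda>i. e i)) \<phi>))
    (\<lambda>e. \<forall>n p h d l x y. array_conditions M n p h d l x y
        (\<lambda>a b l x y. sat M (prepend [a, b, l, x, y] (\<lambda>i. e i)) \<phi>) \<longrightarrow>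
      size_bound M p h d l (\<lambda>a b l x y. sat M (prepend [a, b, l, x, y] (\<lambda>i. e i)) \<phi>))"
    (is "codef M _ ?M")
    unfolding array_conditions_def size_bound_def coded_sum_def coded_card_def valid_code_def
      code_extends_def coded_enum_def decode_eq_iff
    by (intro codef_intros codef_fn_beta codef_sat5)
  then have "?M e" by (rule transfer) (intro allI impI, rule array_bound_nat)
  with assms show ?thesis by blast
qed

text \<open>In \<open>M\<close> the relation \<open>T\<close> pins down the summand, so the coded
  partial sums satisfy the recursion of \<open>msum\<close>.\<close>

lemma msum_eq:
  assumes "coded_sum M T k v" and T: "\<And>i m. i \<prec>\<^bsub>M\<^esub> k \<Longrightarrow> T i m \<Longrightarrow> f i = m"
  shows "msum M f k = v"
proof -
  obtain x y where "beta M x y \<zero>\<^bsub>M\<^esub> = \<zero>\<^bsub>M\<^esub>" and v: "beta M x y k = v"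
    and step: "\<And>i. i \<prec>\<^bsub>M\<^esub> k \<Longrightarrow> \<exists>m. T i m \<and> beta M x y (i \<oplus>\<^bsub>M\<^esub> \<one>\<^bsub>M\<^esub>) = beta M x y i \<oplus>\<^bsub>M\<^esub> m"
    using assms(1) unfolding coded_sum_def by blast
  moreover have "beta M x y (i \<oplus>\<^bsub>M\<^esub> \<one>\<^bsub>M\<^esub>) = beta M x y i \<oplus>\<^bsub>M\<^esub> f i" if "i \<prec>\<^bsub>M\<^esub> k" for i
    using step[OF that] T[OF that] by auto
  ultimately show ?thesis unfolding msum_def by (subst mrec_eq) auto
qed

text \<open>Exhaustion in \<open>coded_card\<close> speaks only about codes; the elements of
  \<open>X\<close> being coded sequences is what makes the enumeration reach all of
  \<open>X\<close>.\<close>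

lemma mcard_eq_coded_card:
  assumes "coded_card M P m"
    and P: "\<And>l x y. P l x y \<longleftrightarrow> decode M l x y \<in> X" and X: "\<And>r. r \<in> X \<Longrightarrow> is_seq M r"
  shows "mcard M X = m"
proof -
  obtain x1 y1 x2 y2 x3 y3 where
    "\<And>i. i \<prec>\<^bsub>M\<^esub> m \<Longrightarrow> P (beta M x1 y1 i) (beta M x2 y2 i) (beta M x3 y3 i)"
    and inj: "\<And>i j. i \<prec>\<^bsub>M\<^esub> m \<Longrightarrow> j \<prec>\<^bsub>M\<^esub> m \<Longrightarrow>
      coded_enum M x1 y1 x2 y2 x3 y3 i = coded_enum M x1 y1 x2 y2 x3 y3 j \<Longrightarrow> i = j"
    and surj: "\<And>l x y. P l x y \<Longrightarrow>
      \<exists>i. i \<prec>\<^bsub>M\<^esub> m \<and> decode M l x y = coded_enum M x1 y1 x2 y2 x3 y3 i"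
    using assms(1) unfolding coded_card_def by blast
  then have into: "coded_enum M x1 y1 x2 y2 x3 y3 i \<in> X" if "i \<prec>\<^bsub>M\<^esub> m" for i
    using that P by (simp add: coded_enum_def)
  show ?thesis
  proof (rule mcard_eq, rule bij_betw_imageI)
    show "inj_on (coded_enum M x1 y1 x2 y2 x3 y3) (below M m)"
      by (rule inj_onI) (simp add: below_def inj)
    show "coded_enum M x1 y1 x2 y2 x3 y3 ` below M m = X"
    proof (intro equalityI subsetI)
      fix r assume r: "r \<in> X"
      then obtain l x y where "r = decode M l x y" using X unfolding is_seq_def by blast
      then show "r \<in> coded_enum M x1 y1 x2 y2 x3 y3 ` below M m"
        using surj[of l x y] r P[of l x y] by (auto simp: below_def)
    qed (auto simp: below_def into)
  qed
qed

section \<open>Standard powers and the length bound of \<open>Oseqs\<close>\<close>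

lemma spow_Suc: "spow M x (Suc c) = x \<otimes>\<^bsub>M\<^esub> spow M x c"
  by (simp add: spow_def)

lemma spow_mono:
  assumes "\<one>\<^bsub>M\<^esub> \<oplus>\<^bsub>M\<^esub> \<one>\<^bsub>M\<^esub> \<preceq>\<^bsub>M\<^esub> x" "c \<le> c'"
  shows "spow M x c \<preceq>\<^bsub>M\<^esub> spow M x c'"
  using assms(2)
proof (induction rule: dec_induct)
  case (step k)
  then show ?case using le_trans le_mul[OF assms(1)] unfolding spow_Suc by blast
qed (simp add: le_def)

lemma spow_le_one:
  assumes "x \<prec>\<^bsub>M\<^esub> \<one>\<^bsub>M\<^esub> \<oplus>\<^bsub>M\<^esub> \<one>\<^bsub>M\<^esub>"
  shows "spow M x c \<preceq>\<^bsub>M\<^esub> \<one>\<^bsub>M\<^esub>"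
proof (induction c)
  case 0
  show ?case by (simp add: spow_def le_def)
qed (simp add: spow_Suc mul_le_one[OF assms])

lemma seq_order_short:
  assumes "is_seq M r" "seqlen M r \<preceq>\<^bsub>M\<^esub> \<one>\<^bsub>M\<^esub>"
  shows "seq_order M r = {}"
proof -
  obtain l x y where r: "r = decode M l x y" using assms(1) unfolding is_seq_def by blast
  have "False" if "i \<prec>\<^bsub>M\<^esub> j" "r j = Some v" for i j v
  proof -
    from that(2) have "j \<prec>\<^bsub>M\<^esub> l" by (simp add: r decode_def split: if_splits)
    then show False using no_pair_below_one[OF _ that(1)] assms(2) by (simp add: r seqlen_decode)
  qed
  then show ?thesis unfolding seq_order_def by blast
qed

text \<open>
  If the bit length is at least \<open>2\<close>, the sum of two standard powers of it is below another one;
  otherwise sequences in \<^const>\<open>Oseqs\<close> have at most one entry and induce the empty order.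
\<close>

lemma compatibleI:
  assumes r: "r \<in> Oseqs M n" and r': "r' \<in> Oseqs M n"
    and t: "valid_code M n l x y" "l \<preceq>\<^bsub>M\<^esub> seqlen M r \<oplus>\<^bsub>M\<^esub> seqlen M r'"
    and ext: "extends M (decode M l x y) r" "extends M (decode M l x y) r'"
  shows "compatible M n r r'"
proof -
  let ?b = "bitlen M n"
  obtain c c' where c: "seqlen M r \<preceq>\<^bsub>M\<^esub> spow M ?b c" and c': "seqlen M r' \<preceq>\<^bsub>M\<^esub> spow M ?b c'"
    using r r' unfolding Oseqs_def by blast
  show ?thesis
  proof (cases "?b \<prec>\<^bsub>M\<^esub> \<one>\<^bsub>M\<^esub> \<oplus>\<^bsub>M\<^esub> \<one>\<^bsub>M\<^esub>")
    case True
    have "seqlen M r' \<preceq>\<^bsub>M\<^esub> \<one>\<^bsub>M\<^esub>" by (rule le_trans[OF c' spow_le_one[OF True]])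
    moreover have "is_seq M r'" using r' by (simp add: Oseqs_def)
    \<comment> \<open>As \<open>r'\<close> induces the empty order, \<open>r\<close> itself serves
      as the common extension instead of the given code.\<close>
    ultimately have "extends M r r'" by (simp add: extends_def seq_order_short)
    moreover have "extends M r r" by (simp add: extends_def)
    ultimately show ?thesis using r unfolding compatible_def by blast
  next
    case False
    then have b: "\<one>\<^bsub>M\<^esub> \<oplus>\<^bsub>M\<^esub> \<one>\<^bsub>M\<^esub> \<preceq>\<^bsub>M\<^esub> ?b" using less_total unfolding le_def by blast
    \<comment> \<open>Both lengths are below the power with exponent \<open>c + c'\<close>; one
      further factor of at least 2 absorbs the doubling.\<close>
    let ?p = "spow M ?b (c + c')"
    have "seqlen M r \<preceq>\<^bsub>M\<^esub> ?p" "seqlen M r' \<preceq>\<^bsub>M\<^esub> ?p"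
      using le_trans[OF c spow_mono[OF b]] le_trans[OF c' spow_mono[OF b]] by simp_all
    then have "seqlen M r \<oplus>\<^bsub>M\<^esub> seqlen M r' \<preceq>\<^bsub>M\<^esub> ?p \<oplus>\<^bsub>M\<^esub> ?p" by (rule add_mono)
    from le_trans[OF this double_le_mul[OF b]]
    have "seqlen M r \<oplus>\<^bsub>M\<^esub> seqlen M r' \<preceq>\<^bsub>M\<^esub> spow M ?b (Suc (c + c'))" by (simp add: spow_Suc)
    from le_trans[OF t(2) this] have "seqlen M (decode M l x y) \<preceq>\<^bsub>M\<^esub> spow M ?b (Suc (c + c'))"
      by (simp add: seqlen_decode)
    then have "decode M l x y \<in> Oseqs M n"
      using t(1) unfolding Oseqs_def valid_code_iff is_seq_def by blast
    with ext show ?thesis unfolding compatible_def by blast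
  qed
qed

lemma array_size_le:
  assumes array: "is_array M n s p h A"
    and len: "\<forall>a \<in> below M p. \<forall>b \<in> below M h. \<forall>r \<in> A a b. seqlen M r \<preceq>\<^bsub>M\<^esub> seqlen M s \<oplus>\<^bsub>M\<^esub> d"
  shows "array_size M p h A \<preceq>\<^bsub>M\<^esub>
    h \<otimes>\<^bsub>M\<^esub> mdiv M (mfact M (seqlen M s \<oplus>\<^bsub>M\<^esub> d)) (mfact M (seqlen M s))"
proof -
  have s: "s \<in> Oseqs M n" using array by (simp add: is_array_def)
  then obtain l x y where s_code: "s = decode M l x y" unfolding Oseqs_def is_seq_def by blast
  then have s_len: "seqlen M s = l" by (simp add: seqlen_decode)
  from array have "definable M 5 (\<lambda>xs. xs ! 0 \<prec>\<^bsub>M\<^esub> p \<and> xs ! 1 \<prec>\<^bsub>M\<^esub> h \<and>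
      decode M (xs ! 2) (xs ! 3) (xs ! 4) \<in> A (xs ! 0) (xs ! 1))"
    by (simp add: is_array_def definable_family_def)
  then obtain \<phi> e where \<phi>: "\<forall>xs. length xs = 5 \<longrightarrow> (xs ! 0 \<prec>\<^bsub>M\<^esub> p \<and> xs ! 1 \<prec>\<^bsub>M\<^esub> h \<and>
      decode M (xs ! 2) (xs ! 3) (xs ! 4) \<in> A (xs ! 0) (xs ! 1) \<longleftrightarrow> sat M (prepend xs e) \<phi>)"
    unfolding definable_iff_prepend by blast
  let ?R = "\<lambda>a b l x y. sat M (prepend [a, b, l, x, y] e) \<phi>"
  have R: "?R a b l x y \<longleftrightarrow> a \<prec>\<^bsub>M\<^esub> p \<and> b \<prec>\<^bsub>M\<^esub> h \<and> decode M l x y \<in> A a b" for a b l x y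
    using \<phi>[rule_format, of "[a, b, l, x, y]"] by simp
  have cell: "r \<in> Oseqs M n \<and> extends M r s \<and> seqlen M r \<preceq>\<^bsub>M\<^esub> l \<oplus>\<^bsub>M\<^esub> d"
    if "a \<prec>\<^bsub>M\<^esub> p" "b \<prec>\<^bsub>M\<^esub> h" "r \<in> A a b" for a b r
  proof -
    from array have "A a b \<subseteq> Oseqs M n" "\<forall>r \<in> A a b. extends M r s"
      using that(1,2) by (simp_all add: is_array_def below_def)
    then show ?thesis using len that unfolding below_def s_len by blast
  qed
  \<comment> \<open>Merges the same-cell and same-column clauses into the form used by
    \<open>array_conditions\<close>.\<close>
  have incompatible: "\<not> compatible M n r r'"
    if "a \<prec>\<^bsub>M\<^esub> p" "a' \<prec>\<^bsub>M\<^esub> p" "b \<prec>\<^bsub>M\<^esub> h" "r \<in> A a b" "r' \<in> A a' b" "a \<noteq> a' \<or> r \<noteq> r'"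
    for a a' b r r'
  proof -
    from array have "\<forall>r \<in> A a b. \<forall>r' \<in> A a b. r \<noteq> r' \<longrightarrow> \<not> compatible M n r r'"
      "a \<noteq> a' \<longrightarrow> (\<forall>r \<in> A a b. \<forall>r' \<in> A a' b. \<not> compatible M n r r')"
      using that(1-3) by (simp_all add: is_array_def below_def)
    then show ?thesis using that(4-6) by blast
  qed
  have "array_conditions M n p h d l x y ?R"
    unfolding array_conditions_def code_extends_iff R
  proof (intro conjI allI impI)
    show "valid_code M n l x y" using s unfolding s_code Oseqs_def valid_code_iff by blast
  next
    fix a b l1 x1 y1
    assume "a \<prec>\<^bsub>M\<^esub> p \<and> b \<prec>\<^bsub>M\<^esub> h \<and> decode M l1 x1 y1 \<in> A a b"
    then have c: "decode M l1 x1 y1 \<in> Oseqs M n" "extends M (decode M l1 x1 y1) s"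
      "seqlen M (decode M l1 x1 y1) \<preceq>\<^bsub>M\<^esub> l \<oplus>\<^bsub>M\<^esub> d"
      using cell by blast+
    show "valid_code M n l1 x1 y1" using c(1) unfolding Oseqs_def valid_code_iff by blast
    show "l1 \<preceq>\<^bsub>M\<^esub> l \<oplus>\<^bsub>M\<^esub> d" using c(3) by (simp add: seqlen_decode)
    show "extends M (decode M l1 x1 y1) (decode M l x y)" using c(2) by (simp add: s_code)
  next
    fix a a' b l1 x1 y1 l2 x2 y2
    assume r: "a \<prec>\<^bsub>M\<^esub> p \<and> b \<prec>\<^bsub>M\<^esub> h \<and> decode M l1 x1 y1 \<in> A a b"
      and r': "a' \<prec>\<^bsub>M\<^esub> p \<and> b \<prec>\<^bsub>M\<^esub> h \<and> decode M l2 x2 y2 \<in> A a' b"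
      and "a \<noteq> a' \<or> decode M l1 x1 y1 \<noteq> decode M l2 x2 y2"
    then have "\<not> compatible M n (decode M l1 x1 y1) (decode M l2 x2 y2)"
      using incompatible by blast
    moreover have "decode M l1 x1 y1 \<in> Oseqs M n" "decode M l2 x2 y2 \<in> Oseqs M n"
      using cell r r' by blast+
    \<comment> \<open>\<open>compatibleI\<close> turns such a short common extension into
      compatibility in \<open>Oseqs\<close>.\<close>
    ultimately show "\<not> (\<exists>l3 x3 y3. l3 \<preceq>\<^bsub>M\<^esub> l1 \<oplus>\<^bsub>M\<^esub> l2 \<and> valid_code M n l3 x3 y3 \<and>
        extends M (decode M l3 x3 y3) (decode M l1 x1 y1) \<and>
        extends M (decode M l3 x3 y3) (decode M l2 x2 y2))"
      using compatibleI[of "decode M l1 x1 y1" n "decode M l2 x2 y2"] by (auto simp: seqlen_decode)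
  qed
  from array_bound[OF this] obtain u v q t where
    fact: "beta M u v \<zero>\<^bsub>M\<^esub> = \<one>\<^bsub>M\<^esub>"
      "\<And>i. i \<prec>\<^bsub>M\<^esub> l \<oplus>\<^bsub>M\<^esub> d \<Longrightarrow>
        beta M u v (i \<oplus>\<^bsub>M\<^esub> \<one>\<^bsub>M\<^esub>) = (i \<oplus>\<^bsub>M\<^esub> \<one>\<^bsub>M\<^esub>) \<otimes>\<^bsub>M\<^esub> beta M u v i"
    and pos: "\<zero>\<^bsub>M\<^esub> \<prec>\<^bsub>M\<^esub> beta M u v l"
    and q: "beta M u v (l \<oplus>\<^bsub>M\<^esub> d) = q \<otimes>\<^bsub>M\<^esub> beta M u v l"
    and t: "coded_sum M (\<lambda>a w. coded_sum M (\<lambda>b m. coded_card M (?R a b) m) h w) p t"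
    and t_le: "t \<preceq>\<^bsub>M\<^esub> h \<otimes>\<^bsub>M\<^esub> q"
    unfolding size_bound_def by blast
  have "mfact M (l \<oplus>\<^bsub>M\<^esub> d) = beta M u v (l \<oplus>\<^bsub>M\<^esub> d)"
    unfolding mfact_def by (rule mrec_eq) (simp_all add: fact)
  \<comment> \<open>The recursion equations of the table hold below \<open>l \<oplus> d\<close>,
    hence below \<open>l\<close>.\<close>
  moreover have "mfact M l = beta M u v l"
    unfolding mfact_def by (rule mrec_eq) (simp_all add: fact less_add_right)
  ultimately have "mdiv M (mfact M (l \<oplus>\<^bsub>M\<^esub> d)) (mfact M l) = q"
    using mdiv_exact[OF pos] by (simp add: q)
  moreover have "mcard M (A a b) = m" if "a \<prec>\<^bsub>M\<^esub> p" "b \<prec>\<^bsub>M\<^esub> h" "coded_card M (?R a b) m" for a b m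
  proof (rule mcard_eq_coded_card[OF that(3)])
    show "?R a b l x y \<longleftrightarrow> decode M l x y \<in> A a b" for l x y using R that by simp
    show "is_seq M r" if "r \<in> A a b" for r
      using cell[OF \<open>a \<prec>\<^bsub>M\<^esub> p\<close> \<open>b \<prec>\<^bsub>M\<^esub> h\<close> that] by (simp add: Oseqs_def)
  qed
  \<comment> \<open>The outer use of \<open>msum_eq\<close> identifies the sum over
    \<open>a\<close>, the inner one each row sum over \<open>b\<close>, whose summands are the
    cardinalities just determined.\<close>
  then have "array_size M p h A = t"
    unfolding array_size_def by (intro msum_eq[OF t] msum_eq)
  ultimately show ?thesis using t_le by (simp add: s_len)
qed

end

theorem theorem4p9:
  fixes M :: "'m arith" and n p h d :: 'm and s :: "'m mseq"
    and A :: "'m \<Rightarrow> 'm \<Rightarrow> 'm mseq set"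
  assumes "true_arithmetic M"
    and "countable (UNIV :: 'm set)"
    and "nonstandard_model M"
    and "n \<notin> standard M"
    and "is_array M n s p h A"
    and "\<forall>a \<in> below M p. \<forall>b \<in> below M h. \<forall>r \<in> A a b.
           seqlen M r \<preceq>\<^bsub>M\<^esub> seqlen M s \<oplus>\<^bsub>M\<^esub> d"
  shows "array_size M p h A \<preceq>\<^bsub>M\<^esub>
    h \<otimes>\<^bsub>M\<^esub> mdiv M (mfact M (seqlen M s \<oplus>\<^bsub>M\<^esub> d)) (mfact M (seqlen M s))"
proof -
  interpret arithmetic_model M by (rule arithmetic_model.intro[OF assms(1)])
  show ?thesis by (rule array_size_le[OF assms(5,6)])
qed

end
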